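(* Let $m\ge1$. Almost all $w\in\bigotimes^3\mathbb{C}^m$ are polystable.
   Context: Work over $\mathbb{C}$. $\mathrm{GL}_m^3$ acts on $\bigotimes^3\mathbb{C}^m$ by $(g_1,g_2,g_3)w=(g_1\otimes g_2\otimes g_3)w$. A tensor $w\in\bigotimes^3\mathbb{C}^m$ is polystable if its $\mathrm{SL}_m^3$-orbit is closed. "Almost all" means: for all $w$ in some nonempty Zariski open subset. *)

theory Defs
  imports "HOL-Analysis.Analysis"
begin

text \<open>A tensor in \<open>\<Otimes>\<^sup>3 \<complex>\<^sup>m\<close> is given by its coordinates \<open>w $ i $ j $ k\<close> with respect
  to the basis \<open>e\<^sub>i \<otimes> e\<^sub>j \<otimes> e\<^sub>k\<close>; here \<open>m = CARD('m)\<close>, which is at least 1 for every finite type.\<close>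

type_synonym 'm tensor3 = "complex ^ 'm ^ 'm ^ 'm"

definition tensor_act ::
    "(complex^'m^'m) \<times> (complex^'m^'m) \<times> (complex^'m^'m) \<Rightarrow> 'm::finite tensor3 \<Rightarrow> 'm tensor3" where
  "tensor_act = (\<lambda>(g1, g2, g3) w.
     (\<chi> i j k. \<Sum>a\<in>UNIV. \<Sum>b\<in>UNIV. \<Sum>c\<in>UNIV. g1 $ i $ a * g2 $ j $ b * g3 $ k $ c * w $ a $ b $ c))"

definition SL :: "(complex ^ 'm ^ 'm::finite) set" where
  "SL = {g. det g = 1}"

definition SL_orbit :: "'m::finite tensor3 \<Rightarrow> 'm tensor3 set" where
  "SL_orbit w = {tensor_act g w | g. g \<in> SL \<times> SL \<times> SL}"

inductive polynomial_fun :: "('m::finite tensor3 \<Rightarrow> complex) \<Rightarrow> bool" where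
  const: "polynomial_fun (\<lambda>w. c)"
| coord: "polynomial_fun (\<lambda>w. w $ i $ j $ k)"
| add: "polynomial_fun f \<Longrightarrow> polynomial_fun g \<Longrightarrow> polynomial_fun (\<lambda>w. f w + g w)"
| mult: "polynomial_fun f \<Longrightarrow> polynomial_fun g \<Longrightarrow> polynomial_fun (\<lambda>w. f w * g w)"

definition zariski_closed :: "'m::finite tensor3 set \<Rightarrow> bool" where
  "zariski_closed S \<longleftrightarrow> (\<exists>F. (\<forall>f\<in>F. polynomial_fun f) \<and> S = {w. \<forall>f\<in>F. f w = 0})"

definition zariski_open :: "'m::finite tensor3 set \<Rightarrow> bool" where
  "zariski_open U \<longleftrightarrow> zariski_closed (- U)"

text \<open>Closedness of the orbit is meant in the Zariski topology. It implies closedness in the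
  Euclidean topology; for orbits of algebraic groups over \<open>\<complex>\<close> the two are equivalent.\<close>

definition polystable :: "'m::finite tensor3 \<Rightarrow> bool" where
  "polystable w \<longleftrightarrow> zariski_closed (SL_orbit w)"

definition almost_all :: "('m::finite tensor3 \<Rightarrow> bool) \<Rightarrow> bool" where
  "almost_all P \<longleftrightarrow> (\<exists>U. zariski_open U \<and> U \<noteq> {} \<and> (\<forall>w\<in>U. P w))"

end

theory Submission
  imports Defs
    "HOL-Computational_Algebra.Fundamental_Theorem_Algebra"
    "HOL-Computational_Algebra.Fraction_Field"
begin

text \<open>
  Call a tensor stable if no nontrivial triple of weights (one real weight vector of sum zero per
  tensor factor) destabilises it, that is, if no change of bases moves it into the span of the
  basis tensors of nonnegative weight. The case \<open>m = 2\<close> apart, the theorem follows from three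
  facts: stable tensors are polystable, stability is a Zariski open condition, and stable tensors
  exist.

  The first two facts are limit arguments. A point \<open>v\<close> in the Zariski closure of the image of a
  rational map \<open>\<psi>\<close> on affine space is a specialisation of the generic point of the image: in the
  field of rational functions, \<open>P(\<psi>) \<mapsto> P(v)\<close> is a well-defined homomorphism on the subring
  generated by the coordinates of \<open>\<psi>\<close>, and by Chevalley's extension theorem
  (\<open>place_extension\<close>) it extends to a valuation ring \<open>R\<close> with residue map \<open>\<phi>\<close> onto
  \<open>\<complex>\<close> (\<open>place_at_limit\<close>). So \<open>R\<close> plays the role of the germs at the limit of a
  curve, without any curve being chosen.

  For a stable \<open>w\<close> and the generic \<open>g \<in> SL\<^sub>m\<^sup>3\<close> with \<open>g w\<close> specialising to \<open>v\<close>, write \<open>g\<close> in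
  Smith form \<open>k d k'\<close> over \<open>R\<close>. If some entry of \<open>d\<close> were not a unit of \<open>R\<close>, a real-valued
  valuation of these entries would supply weights, and the reduction of \<open>k'\<close> would move \<open>w\<close> into
  their nonnegative part (\<open>bounded_orbit_point\<close>). Hence \<open>g\<close> is defined over \<open>R\<close> and
  \<open>v = \<phi>(g) w\<close>: the orbit is closed (\<open>stable_imp_polystable\<close>). This is the argument of Hilbert
  and Mumford.

  For openness, the tensors destabilised by weights \<open>a, b, c\<close> are the \<open>h s\<close> with \<open>h\<close> invertible
  and \<open>s\<close> supported on nonnegative weights. If \<open>h s\<close> specialises to \<open>v\<close>, an Iwasawa
  decomposition of the inverse of \<open>h\<close> over \<open>R\<close> replaces \<open>h\<close> by a matrix that is invertible over
  \<open>R\<close>, at the expense of a parabolic matrix that preserves the support of \<open>s\<close>; reduction then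
  destabilises \<open>v\<close> (\<open>closed_movable_into\<close>). Only finitely many supports occur, so the unstable
  tensors form a Zariski closed set.

  Finally, for \<open>m \<ge> 3\<close> the tensor \<open>\<Sum>\<^sub>i e\<^sub>i \<otimes> e\<^sub>i \<otimes> e\<^sub>i - (2/m\<^sup>2) e \<otimes> e \<otimes> e\<close>, with \<open>e\<close> the sum of the
  basis vectors, is stable: its slices are orthonormal in each direction and it is annihilated by no
  nonzero triple of traceless matrices, so the criterion of Kempf and Ness applies
  (\<open>kempf_ness_stable\<close>, \<open>stable_perturbed_unit\<close>). For \<open>m = 1\<close> there are no nonzero weights of sum
  zero. For \<open>m = 2\<close> generic tensors have a stabiliser of positive dimension and are not stable;
  there the orbits with nonzero hyperdeterminant are exactly the level sets of the
  hyperdeterminant.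
\<close>

section \<open>Extending homomorphisms to places\<close>

text \<open>The field \<open>'l\<close> will be a field of rational functions. The embedding of the complex numbers
  is a parameter, because it differs from one such field to another.\<close>

locale complex_extension =
  fixes emb :: "complex \<Rightarrow> 'l::field"
  assumes emb_1: "emb 1 = 1"
    and emb_add: "emb (z + z') = emb z + emb z'"
    and emb_mult: "emb (z * z') = emb z * emb z'"
begin

lemma emb_0: "emb 0 = 0"
  using emb_add[of 0 0] by (metis add.right_neutral add_left_cancel)

lemma emb_minus: "emb (- z) = - emb z"
  using emb_add[of z "- z"] by (simp add: emb_0 eq_neg_iff_add_eq_0 add.commute)

text \<open>A homomorphism over \<open>\<complex>\<close> from a subring of \<open>'l\<close> to \<open>\<complex>\<close> is encoded by its graph, a subring
  of \<open>'l \<times> \<complex>\<close>. The last clause expresses that the graph is single-valued. In this form one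
  homomorphism extends another iff the graphs are included, and unions of chains are immediate.\<close>

definition partial_hom :: "('l \<times> complex) set \<Rightarrow> bool" where
  "partial_hom G \<longleftrightarrow> (\<forall>z. (emb z, z) \<in> G) \<and>
     (\<forall>x c y d. (x, c) \<in> G \<longrightarrow> (y, d) \<in> G \<longrightarrow> (x + y, c + d) \<in> G \<and> (x * y, c * d) \<in> G) \<and>
     (\<forall>c. (0, c) \<in> G \<longrightarrow> c = 0)"

context
  fixes G assumes G: "partial_hom G"
begin

lemma partial_hom_emb: "(emb z, z) \<in> G"
  and partial_hom_add: "(x, c) \<in> G \<Longrightarrow> (y, d) \<in> G \<Longrightarrow> (x + y, c + d) \<in> G"
  and partial_hom_mult: "(x, c) \<in> G \<Longrightarrow> (y, d) \<in> G \<Longrightarrow> (x * y, c * d) \<in> G"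
  and partial_hom_zero: "(0, c) \<in> G \<Longrightarrow> c = 0"
  using G by (auto simp: partial_hom_def)

lemma partial_hom_0: "(0, 0) \<in> G"
  using partial_hom_emb[of 0] by (simp add: emb_0)

lemma partial_hom_1: "(1, 1) \<in> G"
  using partial_hom_emb[of 1] by (simp add: emb_1)

lemma partial_hom_minus: "(x, c) \<in> G \<Longrightarrow> (- x, - c) \<in> G"
  using partial_hom_mult[OF partial_hom_emb[of "- 1"]] by (simp add: emb_minus emb_1)

lemma partial_hom_unique: "(x, c) \<in> G \<Longrightarrow> (x, d) \<in> G \<Longrightarrow> c = d"
  using partial_hom_add[OF _ partial_hom_minus, of x c x d] partial_hom_zero[of "c - d"] by simp

lemma partial_hom_sum: "(\<And>i. i \<in> I \<Longrightarrow> (f i, g i) \<in> G) \<Longrightarrow> (sum f I, sum g I) \<in> G"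
  by (induction I rule: infinite_finite_induct) (auto intro: partial_hom_0 partial_hom_add)

text \<open>The two polynomials correspond under the homomorphism acting on coefficients. A relation between
  pairs avoids extending the homomorphism arbitrarily outside its domain.\<close>

definition coeffwise :: "'l poly \<Rightarrow> complex poly \<Rightarrow> bool" where
  "coeffwise P p \<longleftrightarrow> (\<forall>i. (coeff P i, coeff p i) \<in> G)"

lemma coeffwise_add: "coeffwise P p \<Longrightarrow> coeffwise Q q \<Longrightarrow> coeffwise (P + Q) (p + q)"
  by (auto simp: coeffwise_def intro: partial_hom_add)

lemma coeffwise_minus: "coeffwise P p \<Longrightarrow> coeffwise (- P) (- p)"
  by (auto simp: coeffwise_def intro: partial_hom_minus)

lemma coeffwise_diff: "coeffwise P p \<Longrightarrow> coeffwise Q q \<Longrightarrow> coeffwise (P - Q) (p - q)"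
  using coeffwise_add[OF _ coeffwise_minus, of P p Q q] by simp

lemma coeffwise_mult: "coeffwise P p \<Longrightarrow> coeffwise Q q \<Longrightarrow> coeffwise (P * Q) (p * q)"
  by (auto simp: coeffwise_def coeff_mult intro!: partial_hom_sum partial_hom_mult)

lemma coeffwise_monom: "(x, c) \<in> G \<Longrightarrow> coeffwise (monom x n) (monom c n)"
  by (auto simp: coeffwise_def partial_hom_0)

lemma coeffwise_map_emb: "coeffwise (map_poly emb q) q"
  by (auto simp: coeffwise_def coeff_map_poly emb_0 partial_hom_emb)

lemma coeffwise_const: "(x, c) \<in> G \<Longrightarrow> coeffwise [:x:] [:c:]"
  using coeffwise_monom[of x c 0] by (simp add: monom_0)

lemma coeffwise_X: "coeffwise [:0, 1:] [:0, 1:]"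
  using coeffwise_monom[OF partial_hom_1, of 1] by (simp add: monom_altdef)

text \<open>Write \<open>A\<close> for the domain of the homomorphism and \<open>\<mm>\<close> for its kernel. A value \<open>c\<close> for \<open>x\<close> is
  admissible iff it is a common root of the images of all relations \<open>P(x) = 0\<close> with coefficients in
  \<open>A\<close>. These images form an ideal of \<open>\<complex>[X]\<close>, which has a root unless it contains 1; and it
  contains 1 iff \<open>\<mm>\<close> generates the unit ideal of \<open>A[x]\<close>, which is what the assumption excludes.\<close>

lemma partial_hom_adjoin:
  assumes no: "\<nexists>P. coeffwise P 1 \<and> poly P x = 0"
  obtains H c where "partial_hom H" "G \<subseteq> H" "(x, c) \<in> H"
proof -
  define J where "J = {p. \<exists>P. coeffwise P p \<and> poly P x = 0}"
  have J_add: "p + q \<in> J" if "p \<in> J" "q \<in> J" for p q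
    using that coeffwise_add unfolding J_def by fastforce
  have J_mult: "q * p \<in> J" if "p \<in> J" for p q
    using that coeffwise_mult[OF coeffwise_map_emb] unfolding J_def by fastforce
  have J1: "1 \<notin> J" using no unfolding J_def by auto
  have "\<exists>c. \<forall>p\<in>J. poly p c = 0"
  proof (cases "J \<subseteq> {0}")
    case True
    then show ?thesis by (metis poly_0 singletonD subsetD)
  next
    case False
    then obtain p0 where p0: "p0 \<in> J" "p0 \<noteq> 0" by auto
    define f where "f = (ARG_MIN degree p. p \<in> J \<and> p \<noteq> 0)"
    have f: "f \<in> J" "f \<noteq> 0" and fmin: "\<And>p. p \<in> J \<Longrightarrow> p \<noteq> 0 \<Longrightarrow> degree f \<le> degree p"
      using arg_min_natI[of "\<lambda>p. p \<in> J \<and> p \<noteq> 0" p0 degree]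
        arg_min_nat_le[of "\<lambda>p. p \<in> J \<and> p \<noteq> 0" _ degree] p0 unfolding f_def by auto
    have dvd: "f dvd p" if "p \<in> J" for p
    proof -
      have "p mod f = p + (- (p div f)) * f"
        by (simp add: minus_mult_div_eq_mod[symmetric] mult.commute)
      then have "p mod f \<in> J" using J_add[OF that J_mult[OF f(1)]] by metis
      then have "p mod f = 0"
        using fmin[of "p mod f"] degree_mod_less[of f p] f(2) by force
      then show ?thesis by auto
    qed
    have "degree f \<noteq> 0"
    proof
      assume "degree f = 0"
      then obtain a where a: "f = [:a:]" by (metis degree_eq_zeroE)
      then have "[:1 / a:] * f = 1" using f(2) by (simp add: one_pCons)
      then show False using J_mult[OF f(1)] J1 by metis
    qed
    then obtain c where "poly f c = 0"
      using fundamental_theorem_of_algebra[of f] constant_degree[of f] by auto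
    then have "[:- c, 1:] dvd p" if "p \<in> J" for p
      using dvd[OF that] by (simp add: poly_eq_0_iff_dvd dvd_trans[of _ f])
    then show ?thesis by (auto simp: poly_eq_0_iff_dvd)
  qed
  then obtain c where c: "\<And>p. p \<in> J \<Longrightarrow> poly p c = 0" by auto
  define H where "H = {(poly P x, poly p c) | P p. coeffwise P p}"
  have "partial_hom H"
    unfolding partial_hom_def
  proof (intro conjI allI impI)
    fix z show "(emb z, z) \<in> H"
      using coeffwise_const[OF partial_hom_emb[of z]] unfolding H_def by force
  next
    fix a b a' b' assume *: "(a, b) \<in> H" "(a', b') \<in> H"
    then obtain P p P' p' where "coeffwise P p" "a = poly P x" "b = poly p c"
      "coeffwise P' p'" "a' = poly P' x" "b' = poly p' c" unfolding H_def by auto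
    then have "a + a' = poly (P + P') x" "b + b' = poly (p + p') c" "coeffwise (P + P') (p + p')"
      "a * a' = poly (P * P') x" "b * b' = poly (p * p') c" "coeffwise (P * P') (p * p')"
      by (simp_all add: coeffwise_add coeffwise_mult)
    then show "(a + a', b + b') \<in> H" "(a * a', b * b') \<in> H"
      unfolding H_def by blast+
  next
    fix d assume "(0, d) \<in> H"
    then obtain P p where "coeffwise P p" "poly P x = 0" "d = poly p c" unfolding H_def by auto
    then show "d = 0" using c unfolding J_def by blast
  qed
  moreover have "G \<subseteq> H"
  proof
    fix y assume "y \<in> G"
    then have "coeffwise [:fst y:] [:snd y:]" by (simp add: coeffwise_const)
    then have "(poly [:fst y:] x, poly [:snd y:] c) \<in> H" unfolding H_def by blast
    then show "y \<in> H" by simp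
  qed
  moreover have "(x, c) \<in> H"
    using coeffwise_X unfolding H_def by force
  ultimately show ?thesis using that by blast
qed

text \<open>A homomorphism always extends to the localisation at its kernel; hence a maximal one is
  defined on a local ring.\<close>

lemma partial_hom_localize:
  assumes "(s, e) \<in> G" "e \<noteq> 0"
  obtains H where "partial_hom H" "G \<subseteq> H" "(inverse s, inverse e) \<in> H"
proof -
  define H where "H = {(x / t, c / d) | x t c d. (x, c) \<in> G \<and> (t, d) \<in> G \<and> d \<noteq> 0}"
  have nz: "t \<noteq> 0" if "(t, d) \<in> G" "d \<noteq> 0" for t d using that partial_hom_zero by auto
  have "partial_hom H"
    unfolding partial_hom_def
  proof (intro conjI allI impI)
    fix z show "(emb z, z) \<in> H"
      using partial_hom_emb[of z] partial_hom_1 unfolding H_def by force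
  next
    fix a b a' b' assume *: "(a, b) \<in> H" "(a', b') \<in> H"
    then obtain x t c d x' t' c' d' where
      1: "a = x / t" "b = c / d" "(x, c) \<in> G" "(t, d) \<in> G" "d \<noteq> 0"
         "a' = x' / t'" "b' = c' / d'" "(x', c') \<in> G" "(t', d') \<in> G" "d' \<noteq> 0"
      unfolding H_def by auto
    have "a + a' = (x * t' + x' * t) / (t * t')" "b + b' = (c * d' + c' * d) / (d * d')"
      using 1 nz by (auto simp: field_simps)
    moreover have "(x * t' + x' * t, c * d' + c' * d) \<in> G" "(t * t', d * d') \<in> G"
      using 1 by (auto intro!: partial_hom_add partial_hom_mult)
    ultimately show "(a + a', b + b') \<in> H" unfolding H_def using 1 by force
    have "a * a' = (x * x') / (t * t')" "b * b' = (c * c') / (d * d')" using 1 by auto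
    moreover have "(x * x', c * c') \<in> G" "(t * t', d * d') \<in> G"
      using 1 by (auto intro!: partial_hom_mult)
    ultimately show "(a * a', b * b') \<in> H" unfolding H_def using 1 by force
  next
    fix e assume "(0, e) \<in> H"
    then obtain x t c d where "0 = x / t" "e = c / d" "(x, c) \<in> G" "(t, d) \<in> G" "d \<noteq> 0"
      unfolding H_def by auto
    then show "e = 0" using nz[of t d] partial_hom_zero[of c] by auto
  qed
  moreover have "G \<subseteq> H"
    using partial_hom_1 unfolding H_def by force
  moreover have "(inverse s, inverse e) \<in> H"
    using partial_hom_1 assms unfolding H_def by (force simp: inverse_eq_divide)
  ultimately show ?thesis using that by blast
qed

text \<open>The extension to \<open>x\<close> and the extension to \<open>1/x\<close> cannot both be obstructed. The lower-degree one
  of the two relations can be turned, by reversing its coefficients and dividing by its constant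
  term (a unit, as it maps to 1), into a monic relation for the other element; this eliminates the
  leading term of the relation of higher degree, and the degrees descend to a contradiction.\<close>

lemma no_double_relation:
  assumes inv: "\<And>s e. (s, e) \<in> G \<Longrightarrow> e \<noteq> 0 \<Longrightarrow> (inverse s, inverse e) \<in> G"
  shows "x \<noteq> 0 \<Longrightarrow> coeffwise P 1 \<Longrightarrow> poly P x = 0 \<Longrightarrow> coeffwise Q 1 \<Longrightarrow> poly Q (inverse x) = 0 \<Longrightarrow> False"
proof (induction "degree P + degree Q" arbitrary: P Q x rule: less_induct)
  case less
  have main: False if PQ: "coeffwise P 1" "poly P x = 0" "coeffwise Q 1" "poly Q (inverse x) = 0" "x \<noteq> 0"
    and le: "degree Q \<le> degree P"
    and IH: "\<And>P'. coeffwise P' 1 \<Longrightarrow> poly P' x = 0 \<Longrightarrow> degree P' < degree P \<Longrightarrow> False"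
    for P Q x
  proof -
    define u where "u = coeff Q 0"
    have u: "(u, 1) \<in> G" using PQ(3) by (auto simp: coeffwise_def u_def dest: spec[of _ 0])
    have u0: "u \<noteq> 0" using u partial_hom_zero[of 1] by auto
    have iu: "(inverse u, 1) \<in> G" using inv[OF u] by simp
    define k where "k = degree Q"
    define n where "n = degree P"
    define S where "S = smult (inverse u) (reflect_poly Q)"
    have degS: "degree S = k" using u0 unfolding S_def k_def u_def by simp
    have leadS: "coeff S k = 1"
      using u0 unfolding S_def k_def u_def by (simp add: coeff_reflect_poly)
    have cS: "coeffwise S (monom 1 k)"
    proof -
      have "(coeff S i, coeff (monom 1 k) i) \<in> G" for i
      proof -
        have "(coeff Q j, if j = 0 then 1 else 0) \<in> G" for j
          using PQ(3) unfolding coeffwise_def by (auto simp: coeff_1 dest: spec[of _ j])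
        from this[of "k - i"] have "(coeff (reflect_poly Q) i, if i = k then 1 else 0) \<in> G"
          by (auto simp: coeff_reflect_poly k_def partial_hom_0 split: if_splits)
        from partial_hom_mult[OF iu this] show ?thesis unfolding S_def by (auto split: if_splits)
      qed
      then show ?thesis by (simp add: coeffwise_def)
    qed
    have Sx: "poly S x = 0"
      using PQ(4,5) unfolding S_def by (simp add: poly_reflect_poly_nz)
    have P0: "P \<noteq> 0"
    proof
      assume "P = 0"
      then have "(0, 1) \<in> G" using PQ(1) by (auto simp: coeffwise_def dest: spec[of _ 0])
      then show False using partial_hom_zero[of 1] by simp
    qed
    have n0: "n > 0"
    proof (rule ccontr)
      assume "\<not> n > 0"
      then obtain a where "P = [:a:]" unfolding n_def by (metis degree_eq_zeroE neq0_conv)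
      then show False using P0 PQ(2) by simp
    qed
    define a where "a = coeff P n"
    have a: "(a, 0) \<in> G"
      using PQ(1) n0 unfolding coeffwise_def a_def by (auto simp: coeff_1 dest: spec[of _ n])
    define P' where "P' = P - monom a (n - k) * S"
    have "coeffwise P' (1 - monom 0 (n - k) * monom 1 k)"
      unfolding P'_def by (intro coeffwise_diff coeffwise_mult coeffwise_monom PQ a cS)
    then have c': "coeffwise P' 1" by simp
    have kn: "k \<le> n" using le by (simp add: k_def n_def)
    have "degree P' \<le> n"
      unfolding P'_def
    proof (rule degree_diff_le)
      show "degree P \<le> n" by (simp add: n_def)
      have "degree (monom a (n - k) * S) \<le> (n - k) + k"
        using degree_mult_le[of "monom a (n - k)" S] degree_monom_le[of a "n - k"] degS by linarith
      then show "degree (monom a (n - k) * S) \<le> n" using kn by simp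
    qed
    moreover have "coeff P' n = 0"
      unfolding P'_def using kn leadS by (simp add: coeff_monom_mult a_def)
    ultimately have "degree P' < n"
      using n0 by (metis degree_0 le_neq_implies_less leading_coeff_0_iff)
    moreover have "poly P' x = 0" using PQ(2) Sx by (simp add: P'_def)
    ultimately show False using IH c' unfolding n_def by blast
  qed
  show False
  proof (cases "degree Q \<le> degree P")
    case True
    have "False" if "coeffwise P' 1" "poly P' x = 0" "degree P' < degree P" for P'
      using less.hyps[of P' Q x] less.prems that by simp
    then show ?thesis by (rule main[OF less.prems(2-5,1) True])
  next
    case False
    have x: "poly P (inverse (inverse x)) = 0" "inverse x \<noteq> 0" using less.prems by auto
    have le: "degree P \<le> degree Q" using False by simp
    have "False" if "coeffwise Q' 1" "poly Q' (inverse x) = 0" "degree Q' < degree Q" for Q'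
      using less.hyps[of P Q' x] less.prems that by simp
    then show ?thesis by (rule main[OF less.prems(4,5,2) x le])
  qed
qed

end

text \<open>Chevalley's extension theorem: by Zorn's lemma there is a maximal extension, and by the
  preceding lemmas its domain contains \<open>x\<close> or \<open>1/x\<close> for each \<open>x\<close>. The residue field
  stays \<open>\<complex>\<close> because \<open>\<complex>\<close> is algebraically closed.\<close>

theorem place_extension:
  assumes G0: "partial_hom G0"
  obtains R \<phi> where
    "\<And>x c. (x, c) \<in> G0 \<Longrightarrow> x \<in> R \<and> \<phi> x = c"
    "\<And>x y. x \<in> R \<Longrightarrow> y \<in> R \<Longrightarrow> x + y \<in> R \<and> \<phi> (x + y) = \<phi> x + \<phi> y"
    "\<And>x y. x \<in> R \<Longrightarrow> y \<in> R \<Longrightarrow> x * y \<in> R \<and> \<phi> (x * y) = \<phi> x * \<phi> y"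
    "\<And>x. x \<notin> R \<Longrightarrow> inverse x \<in> R \<and> \<phi> (inverse x) = 0"
proof -
  define \<A> where "\<A> = {G. partial_hom G \<and> G0 \<subseteq> G}"
  have "\<exists>M\<in>\<A>. \<forall>X\<in>\<A>. M \<subseteq> X \<longrightarrow> X = M"
  proof (rule subset_Zorn)
    fix C assume C: "subset.chain \<A> C"
    show "\<exists>U\<in>\<A>. \<forall>X\<in>C. X \<subseteq> U"
    proof (cases "C = {}")
      case True then show ?thesis using G0 by (auto simp: \<A>_def)
    next
      case False
      have sub: "C \<subseteq> \<A>" and ch: "\<And>X Y. X \<in> C \<Longrightarrow> Y \<in> C \<Longrightarrow> X \<subseteq> Y \<or> Y \<subseteq> X"
        using C by (auto simp: subset_chain_def)
      have ph: "partial_hom X" if "X \<in> C" for X using that sub by (auto simp: \<A>_def)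
      obtain X0 where X0: "X0 \<in> C" using False by auto
      have "partial_hom (\<Union>C)"
        unfolding partial_hom_def
      proof (intro conjI allI impI)
        fix z show "(emb z, z) \<in> \<Union>C" using partial_hom_emb[OF ph[OF X0]] X0 by blast
      next
        fix x c y d assume "(x, c) \<in> \<Union>C" "(y, d) \<in> \<Union>C"
        then obtain X where "X \<in> C" "(x, c) \<in> X" "(y, d) \<in> X" using ch by blast
        then show "(x + y, c + d) \<in> \<Union>C" "(x * y, c * d) \<in> \<Union>C"
          using partial_hom_add[OF ph] partial_hom_mult[OF ph] by blast+
      next
        fix c assume "(0, c) \<in> \<Union>C" then show "c = 0" using partial_hom_zero[OF ph] by blast
      qed
      moreover have "G0 \<subseteq> \<Union>C" using X0 sub by (auto simp: \<A>_def)
      ultimately show ?thesis by (auto simp: \<A>_def)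
    qed
  qed
  then obtain G where G: "partial_hom G" "G0 \<subseteq> G"
    and max: "\<And>H. partial_hom H \<Longrightarrow> G \<subseteq> H \<Longrightarrow> H = G" by (auto simp: \<A>_def)
  have inv: "(inverse s, inverse e) \<in> G" if "(s, e) \<in> G" "e \<noteq> 0" for s e
    using partial_hom_localize[OF G(1) that] max by metis
  define R where "R = Domain G"
  define \<phi> where "\<phi> x = (THE c. (x, c) \<in> G)" for x
  have \<phi>: "x \<in> R \<and> \<phi> x = c" if "(x, c) \<in> G" for x c
    using that partial_hom_unique[OF G(1)] unfolding R_def \<phi>_def by blast
  have R\<phi>: "(x, \<phi> x) \<in> G" if "x \<in> R" for x
    using that \<phi> unfolding R_def by blast
  have val: "inverse x \<in> R \<and> \<phi> (inverse x) = 0" if x: "x \<notin> R" for x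
  proof -
    have x0: "x \<noteq> 0" using x \<phi>[OF partial_hom_0[OF G(1)]] by auto
    have "\<exists>P. coeffwise G P 1 \<and> poly P x = 0"
    proof (rule ccontr)
      assume "\<not> ?thesis"
      then obtain H c where "partial_hom H" "G \<subseteq> H" "(x, c) \<in> H"
        using partial_hom_adjoin[OF G(1)] by metis
      then show False using max \<phi> x by blast
    qed
    then have "\<nexists>Q. coeffwise G Q 1 \<and> poly Q (inverse x) = 0"
      using no_double_relation[OF G(1) inv x0] by blast
    then obtain H c where "partial_hom H" "G \<subseteq> H" "(inverse x, c) \<in> H"
      using partial_hom_adjoin[OF G(1)] by metis
    then have c: "(inverse x, c) \<in> G" using max by blast
    \<comment> \<open>If \<open>c\<close> were nonzero, localising would put \<open>x\<close> itself into the domain.\<close>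
    moreover have "c = 0"
      using inv[OF c] x \<phi> by force
    ultimately show ?thesis using \<phi> by blast
  qed
  show ?thesis
  proof (rule that)
    show "x \<in> R \<and> \<phi> x = c" if "(x, c) \<in> G0" for x c using that G(2) \<phi> by blast
    show "x + y \<in> R \<and> \<phi> (x + y) = \<phi> x + \<phi> y" if "x \<in> R" "y \<in> R" for x y
      using partial_hom_add[OF G(1) R\<phi>[OF that(1)] R\<phi>[OF that(2)]] by (rule \<phi>)
    show "x * y \<in> R \<and> \<phi> (x * y) = \<phi> x * \<phi> y" if "x \<in> R" "y \<in> R" for x y
      using partial_hom_mult[OF G(1) R\<phi>[OF that(1)] R\<phi>[OF that(2)]] by (rule \<phi>)
    show "inverse x \<in> R \<and> \<phi> (inverse x) = 0" if "x \<notin> R" for x by (rule val[OF that])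
  qed
qed

end

section \<open>Polynomial functions and their field of fractions\<close>

inductive polyfn :: "(('v \<Rightarrow> complex) \<Rightarrow> complex) \<Rightarrow> bool" where
  polyfn_const: "polyfn (\<lambda>x. c)"
| polyfn_var: "polyfn (\<lambda>x. x i)"
| polyfn_add: "polyfn f \<Longrightarrow> polyfn g \<Longrightarrow> polyfn (\<lambda>x. f x + g x)"
| polyfn_mult: "polyfn f \<Longrightarrow> polyfn g \<Longrightarrow> polyfn (\<lambda>x. f x * g x)"

text \<open>Polynomials in variables indexed by \<open>'v\<close> are represented by the functions that they define;
  over the infinite field \<open>\<complex>\<close> nothing is lost, and evaluation at a point is the representation map
  itself.\<close>

typedef 'v polyfun = "{f :: ('v \<Rightarrow> complex) \<Rightarrow> complex. polyfn f}"
  morphisms evaluate Polyfun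
  by (auto intro: polyfn_const)

setup_lifting type_definition_polyfun

lemma polyfn_uminus: "polyfn f \<Longrightarrow> polyfn (\<lambda>x. - f x)"
  using polyfn_mult[OF polyfn_const[of "- 1"]] by simp

text \<open>Restriction to lines reduces the absence of zero divisors to univariate polynomials.\<close>

lemma polyfn_on_line:
  assumes "polyfn f"
  shows "\<exists>p. \<forall>t. poly p t = f (\<lambda>i. x i + t * (y i - x i))"
  using assms
proof induction
  case (polyfn_const c)
  show ?case by (rule exI[of _ "[:c:]"]) simp
next
  case (polyfn_var i)
  show ?case by (rule exI[of _ "[:x i, y i - x i:]"]) simp
next
  case (polyfn_add f g)
  then show ?case by (metis poly_add)
next
  case (polyfn_mult f g)
  then show ?case by (metis poly_mult)
qed

lemma polyfn_mult_nonzero: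
  assumes "polyfn f" "polyfn g" "f x \<noteq> 0" "g y \<noteq> 0"
  shows "\<exists>z. f z * g z \<noteq> 0"
proof -
  obtain p q where p: "\<And>t. poly p t = f (\<lambda>i. x i + t * (y i - x i))"
    and q: "\<And>t. poly q t = g (\<lambda>i. x i + t * (y i - x i))"
    using polyfn_on_line[OF assms(1)] polyfn_on_line[OF assms(2)] by metis
  have "p \<noteq> 0" "q \<noteq> 0" using p[of 0] q[of 1] assms(3,4) by auto
  then have "p * q \<noteq> 0" by simp
  then obtain t where "poly (p * q) t \<noteq> 0" using poly_all_0_iff_0 by blast
  then show ?thesis using p q by (metis poly_mult)
qed

instantiation polyfun :: (type) idom
begin

lift_definition zero_polyfun :: "'a polyfun" is "\<lambda>x. 0" by (rule polyfn_const)
lift_definition one_polyfun :: "'a polyfun" is "\<lambda>x. 1" by (rule polyfn_const)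
lift_definition plus_polyfun :: "'a polyfun \<Rightarrow> 'a polyfun \<Rightarrow> 'a polyfun" is
  "\<lambda>f g x. f x + g x" by (rule polyfn_add)
lift_definition times_polyfun :: "'a polyfun \<Rightarrow> 'a polyfun \<Rightarrow> 'a polyfun" is
  "\<lambda>f g x. f x * g x" by (rule polyfn_mult)
lift_definition uminus_polyfun :: "'a polyfun \<Rightarrow> 'a polyfun" is
  "\<lambda>f x. - f x" by (rule polyfn_uminus)
definition "f - g = f + - (g :: 'a polyfun)"

instance
proof
  fix f g h :: "'a polyfun"
  show "f * g * h = f * (g * h)" by transfer (simp add: mult.assoc)
  show "f * g = g * f" by transfer (simp add: mult.commute)
  show "1 * f = f" by transfer simp
  show "f + g + h = f + (g + h)" by transfer (simp add: add.assoc)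
  show "f + g = g + f" by transfer (simp add: add.commute)
  show "0 + f = f" by transfer simp
  show "- f + f = 0" by transfer simp
  show "f - g = f + - g" by (rule minus_polyfun_def)
  show "(f + g) * h = f * h + g * h" by transfer (simp add: distrib_right)
  show "f * (g + h) = f * g + f * h" by transfer (simp add: distrib_left)
  show "0 * f = 0" "f * 0 = 0" by (transfer; simp)+
  show "(0 :: 'a polyfun) \<noteq> 1"
    by (metis zero_polyfun.rep_eq one_polyfun.rep_eq zero_neq_one)
  have nz: "\<exists>x. evaluate f x \<noteq> 0" if "f \<noteq> 0" for f :: "'a polyfun"
    using that by (metis evaluate_inject zero_polyfun.rep_eq ext)
  show "f * g \<noteq> 0" if fg: "f \<noteq> 0" "g \<noteq> 0"
  proof -
    have "polyfn (evaluate f)" "polyfn (evaluate g)" using evaluate by auto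
    then obtain z where "evaluate f z * evaluate g z \<noteq> 0"
      using polyfn_mult_nonzero nz[OF fg(1)] nz[OF fg(2)] by metis
    then have "evaluate (f * g) z \<noteq> evaluate 0 z"
      by (simp add: times_polyfun.rep_eq zero_polyfun.rep_eq)
    then show ?thesis by (rule contrapos_nn) (erule arg_cong)
  qed
qed

end

definition Const :: "complex \<Rightarrow> 'v polyfun" where
  "Const c = Polyfun (\<lambda>x. c)"

definition Var :: "'v \<Rightarrow> 'v polyfun" where
  "Var i = Polyfun (\<lambda>x. x i)"

lemma evaluate_Const [simp]: "evaluate (Const c) x = c"
  by (simp add: Const_def Polyfun_inverse polyfn_const)

lemma evaluate_Var [simp]: "evaluate (Var i) x = x i"
  by (simp add: Var_def Polyfun_inverse polyfn_var)

lemma evaluate_simps [simp]: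
  "evaluate 0 x = 0" "evaluate 1 x = 1" "evaluate (f + g) x = evaluate f x + evaluate g x"
  "evaluate (f * g) x = evaluate f x * evaluate g x" "evaluate (- f) x = - evaluate f x"
  by (simp_all add: plus_polyfun.rep_eq uminus_polyfun.rep_eq times_polyfun.rep_eq
      zero_polyfun.rep_eq one_polyfun.rep_eq)

lemma evaluate_power [simp]: "evaluate (f ^ n) x = evaluate f x ^ n"
  by (induction n) auto

lemma evaluate_sum [simp]: "evaluate (sum f I) x = (\<Sum>i\<in>I. evaluate (f i) x)"
  by (induction I rule: infinite_finite_induct) auto

lemma evaluate_prod [simp]: "evaluate (prod f I) x = (\<Prod>i\<in>I. evaluate (f i) x)"
  by (induction I rule: infinite_finite_induct) auto

lemma evaluate_of_int [simp]: "evaluate (of_int n) x = of_int n"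
proof -
  have *: "evaluate (of_nat n) x = of_nat n" for n by (induction n) auto
  show ?thesis by (cases n rule: int_cases2) (auto simp: *)
qed

lemma evaluate_eqI: "(\<And>x. evaluate f x = evaluate g x) \<Longrightarrow> f = g"
  by (metis evaluate_inject ext)

definition const_fract :: "complex \<Rightarrow> 'v polyfun fract" where
  "const_fract c = Fract (Const c) 1"

interpretation const_fract: complex_extension "const_fract :: complex \<Rightarrow> 'v polyfun fract"
proof
  show "const_fract 1 = (1 :: 'v polyfun fract)"
    unfolding const_fract_def One_fract_def by (auto intro!: arg_cong2[of _ _ _ _ Fract] evaluate_eqI)
  show "const_fract (z + z') = const_fract z + (const_fract z' :: 'v polyfun fract)" for z z'
    by (auto simp: const_fract_def intro!: arg_cong2[of _ _ _ _ Fract] evaluate_eqI)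
  show "const_fract (z * z') = const_fract z * (const_fract z' :: 'v polyfun fract)" for z z'
    by (auto simp: const_fract_def intro!: arg_cong2[of _ _ _ _ Fract] evaluate_eqI)
qed

text \<open>A valuation ring \<open>R\<close> of \<open>'l\<close> over \<open>\<complex>\<close> with residue map \<open>\<phi>\<close> onto \<open>\<complex>\<close>. Elements outside
  \<open>R\<close> are those of negative valuation; their inverses lie in the maximal ideal, the kernel of
  \<open>\<phi>\<close>.\<close>

locale place = complex_extension emb for emb :: "complex \<Rightarrow> 'l::field" +
  fixes R :: "'l set" and \<phi> :: "'l \<Rightarrow> complex"
  assumes emb_R: "emb z \<in> R" and \<phi>_emb: "\<phi> (emb z) = z"
    and R_add: "x \<in> R \<Longrightarrow> y \<in> R \<Longrightarrow> x + y \<in> R"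
    and \<phi>_add: "x \<in> R \<Longrightarrow> y \<in> R \<Longrightarrow> \<phi> (x + y) = \<phi> x + \<phi> y"
    and R_mult: "x \<in> R \<Longrightarrow> y \<in> R \<Longrightarrow> x * y \<in> R"
    and \<phi>_mult: "x \<in> R \<Longrightarrow> y \<in> R \<Longrightarrow> \<phi> (x * y) = \<phi> x * \<phi> y"
    and inverse_R: "x \<notin> R \<Longrightarrow> inverse x \<in> R"
    and \<phi>_inverse: "x \<notin> R \<Longrightarrow> \<phi> (inverse x) = 0"

lemma (in complex_extension) place_extends_partial_hom:
  assumes "partial_hom G"
  obtains R \<phi> where "place emb R \<phi>" "\<And>x c. (x, c) \<in> G \<Longrightarrow> x \<in> R \<and> \<phi> x = c"
proof -
  obtain R \<phi> where 1:
    "\<And>x c. (x, c) \<in> G \<Longrightarrow> x \<in> R \<and> \<phi> x = c"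
    "\<And>x y. x \<in> R \<Longrightarrow> y \<in> R \<Longrightarrow> x + y \<in> R \<and> \<phi> (x + y) = \<phi> x + \<phi> y"
    "\<And>x y. x \<in> R \<Longrightarrow> y \<in> R \<Longrightarrow> x * y \<in> R \<and> \<phi> (x * y) = \<phi> x * \<phi> y"
    "\<And>x. x \<notin> R \<Longrightarrow> inverse x \<in> R \<and> \<phi> (inverse x) = 0"
    by (rule place_extension[OF assms]) blast
  have "place emb R \<phi>"
    by unfold_locales (use 1 partial_hom_emb[OF assms] in \<open>blast+\<close>)
  then show ?thesis using that 1 by blast
qed

text \<open>The assumption \<open>lim\<close> says that \<open>v\<close> lies in the Zariski closure of the image of the rational
  map with coordinates \<open>U i j k / D\<close>. It is exactly what makes \<open>P(U/D) \<mapsto> P(v)\<close> well defined: a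
  polynomial expression in the \<open>U i j k / D\<close> that vanishes as a rational function vanishes on the
  whole image, hence at \<open>v\<close>.\<close>

lemma place_at_limit:
  fixes U :: "'m::finite \<Rightarrow> 'm \<Rightarrow> 'm \<Rightarrow> 'v polyfun" and v :: "'m tensor3"
  assumes D: "D \<noteq> 0"
    and lim: "\<And>P. polynomial_fun P \<Longrightarrow>
      (\<And>x. evaluate D x \<noteq> 0 \<Longrightarrow> P (\<chi> i j k. evaluate (U i j k) x / evaluate D x) = 0) \<Longrightarrow> P v = 0"
  obtains R \<phi> where "place const_fract R \<phi>"
    "\<And>i j k. Fract (U i j k) D \<in> R" "\<And>i j k. \<phi> (Fract (U i j k) D) = v $ i $ j $ k"
proof -
  define \<psi> :: "('v \<Rightarrow> complex) \<Rightarrow> 'm tensor3"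
    where "\<psi> x = (\<chi> i j k. evaluate (U i j k) x / evaluate D x)" for x
  \<comment> \<open>Instead of substituting into \<open>P\<close> formally, the element \<open>P(U/D)\<close> is recognised by its
    values after clearing the denominator \<open>D ^ n\<close>.\<close>
  define G where "G = {(Fract p (D ^ n), P v) | P p n. polynomial_fun P \<and>
    (\<forall>x. evaluate D x \<noteq> 0 \<longrightarrow> P (\<psi> x) * evaluate D x ^ n = evaluate p x)}"
  have GI: "(y, c) \<in> G" if "polynomial_fun P" "y = Fract p (D ^ n)" "c = P v"
    "\<And>x. evaluate D x \<noteq> 0 \<Longrightarrow> P (\<psi> x) * evaluate D x ^ n = evaluate p x" for y c P p n
    using that unfolding G_def by blast
  have Dn: "D ^ n \<noteq> 0" for n using D by simp
  have "const_fract.partial_hom G"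
    unfolding const_fract.partial_hom_def
  proof (intro conjI allI impI)
    fix z show "(const_fract z, z) \<in> G"
      by (rule GI[where P = "\<lambda>_. z" and n = 0 and p = "Const z"])
        (auto simp: const_fract_def intro: polynomial_fun.const)
  next
    fix a c b d assume "(a, c) \<in> G" "(b, d) \<in> G"
    then obtain P p n Q q m where
      1: "a = Fract p (D ^ n)" "c = P v" "polynomial_fun P"
        "\<And>x. evaluate D x \<noteq> 0 \<Longrightarrow> P (\<psi> x) * evaluate D x ^ n = evaluate p x"
      and 2: "b = Fract q (D ^ m)" "d = Q v" "polynomial_fun Q"
        "\<And>x. evaluate D x \<noteq> 0 \<Longrightarrow> Q (\<psi> x) * evaluate D x ^ m = evaluate q x"
      unfolding G_def by auto
    show "(a + b, c + d) \<in> G"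
    proof (rule GI[where P = "\<lambda>w. P w + Q w" and n = "n + m" and p = "p * D ^ m + q * D ^ n"])
      fix x assume "evaluate D x \<noteq> 0"
      then show "(P (\<psi> x) + Q (\<psi> x)) * evaluate D x ^ (n + m) = evaluate (p * D ^ m + q * D ^ n) x"
        using 1(4)[of x, symmetric] 2(4)[of x, symmetric] by (simp add: power_add algebra_simps)
    qed (use 1 2 Dn in \<open>auto intro: polynomial_fun.add simp: power_add\<close>)
    show "(a * b, c * d) \<in> G"
    proof (rule GI[where P = "\<lambda>w. P w * Q w" and n = "n + m" and p = "p * q"])
      fix x assume "evaluate D x \<noteq> 0"
      then show "(P (\<psi> x) * Q (\<psi> x)) * evaluate D x ^ (n + m) = evaluate (p * q) x"
        using 1(4)[of x, symmetric] 2(4)[of x, symmetric] by (simp add: power_add algebra_simps)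
    qed (use 1 2 Dn in \<open>auto intro: polynomial_fun.mult simp: power_add\<close>)
  next
    fix c assume "(0, c) \<in> G"
    then obtain P p n where
      1: "0 = Fract p (D ^ n)" "c = P v" "polynomial_fun P"
        "\<And>x. evaluate D x \<noteq> 0 \<Longrightarrow> P (\<psi> x) * evaluate D x ^ n = evaluate p x" unfolding G_def by auto
    have "p = 0" using 1(1) Dn[of n] by (simp add: Zero_fract_def eq_fract)
    then have "P (\<psi> x) = 0" if "evaluate D x \<noteq> 0" for x using 1(4)[OF that] that by simp
    then show "c = 0" using lim[OF 1(3)] 1(2) unfolding \<psi>_def by blast
  qed
  then obtain R \<phi> where R: "place const_fract R \<phi>" "\<And>x c. (x, c) \<in> G \<Longrightarrow> x \<in> R \<and> \<phi> x = c"
    using const_fract.place_extends_partial_hom by blast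
  have "(Fract (U i j k) D, v $ i $ j $ k) \<in> G" for i j k
    by (rule GI[where P = "\<lambda>w. w $ i $ j $ k" and n = 1 and p = "U i j k"])
      (auto intro: polynomial_fun.coord simp: \<psi>_def)
  then show ?thesis using that R by blast
qed

section \<open>Matrices over a valuation ring\<close>

text \<open>Multiplication by \<open>shear v s\<close> from the left adds multiples of row \<open>s\<close> to the other rows, so
  that it clears column \<open>s\<close> around a pivot at \<open>(s, s)\<close>; the transpose clears row \<open>s\<close>.\<close>

definition shear :: "('n \<Rightarrow> 'a) \<Rightarrow> 'n \<Rightarrow> 'a::comm_ring_1 ^ 'n ^ 'n::finite" where
  "shear v s = (\<chi> r c. if r = c then 1 else if c = s then v r else 0)"

definition exchange :: "'n \<Rightarrow> 'n \<Rightarrow> 'a::comm_ring_1 ^ 'n ^ 'n::finite" where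
  "exchange i j = (\<chi> r c. if c = (if r = i then j else if r = j then i else r) then 1 else 0)"

definition diagonal :: "('n \<Rightarrow> 'a) \<Rightarrow> 'a::comm_ring_1 ^ 'n ^ 'n::finite" where
  "diagonal d = (\<chi> r c. if r = c then d r else 0)"

lemma shear_mult:
  "(shear v s ** M) $ r $ c = M $ r $ c + (if r = s then 0 else v r * M $ s $ c)"
proof -
  have "(shear v s ** M) $ r $ c
      = (\<Sum>x\<in>UNIV. (if x = r then M $ r $ c else 0) + (if x = s then (if r = s then 0 else v r * M $ s $ c) else 0))"
    unfolding matrix_matrix_mult_def vec_lambda_beta
    by (intro sum.cong refl) (auto simp: shear_def)
  then show ?thesis by (simp add: sum.distrib)
qed

lemma mult_transpose_shear:
  "(M ** transpose (shear v s)) $ r $ c = M $ r $ c + (if c = s then 0 else M $ r $ s * v c)"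
proof -
  have "(M ** transpose (shear v s)) $ r $ c
      = (\<Sum>x\<in>UNIV. (if x = c then M $ r $ c else 0) + (if x = s then (if c = s then 0 else M $ r $ s * v c) else 0))"
    unfolding matrix_matrix_mult_def vec_lambda_beta
    by (intro sum.cong refl) (auto simp: shear_def transpose_def)
  then show ?thesis by (simp add: sum.distrib)
qed

lemma mult_exchange:
  "(M ** exchange i j) $ r $ c = M $ r $ (if c = i then j else if c = j then i else c)"
proof -
  have "(M ** exchange i j) $ r $ c
      = (\<Sum>x\<in>UNIV. if x = (if c = i then j else if c = j then i else c)
          then M $ r $ (if c = i then j else if c = j then i else c) else 0)"
    unfolding matrix_matrix_mult_def vec_lambda_beta
    by (intro sum.cong refl) (auto simp: exchange_def)
  then show ?thesis by simp
qed

lemma diagonal_mult: "(diagonal d ** M) $ r $ c = d r * M $ r $ c"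
proof -
  have "(diagonal d ** M) $ r $ c = (\<Sum>x\<in>UNIV. if x = r then d r * M $ r $ c else 0)"
    unfolding matrix_matrix_mult_def vec_lambda_beta
    by (intro sum.cong refl) (auto simp: diagonal_def)
  then show ?thesis by simp
qed

lemma shear_inverse: "shear v s ** shear (\<lambda>r. - v r) s = mat 1"
  by (auto simp: vec_eq_iff shear_mult) (auto simp: shear_def mat_def)

lemma exchange_exchange: "exchange i j ** exchange i j = mat 1"
  by (auto simp: vec_eq_iff mult_exchange) (auto simp: exchange_def mat_def)

lemma diagonal_inverse:
  "(\<And>i. d i \<noteq> 0) \<Longrightarrow> diagonal d ** diagonal (\<lambda>i. inverse (d i :: 'a::field)) = mat 1"
  by (auto simp: vec_eq_iff diagonal_mult) (auto simp: diagonal_def mat_def)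

lemma invertible_fieldI:
  fixes A B :: "'a::field ^ 'n ^ 'n::finite"
  shows "A ** B = mat 1 \<Longrightarrow> invertible A"
  unfolding invertible_def using matrix_left_right_inverse by blast

lemma invertible_row_nonzero:
  fixes A :: "'a::field ^ 'n ^ 'n::finite"
  assumes "invertible A" shows "\<exists>c. A $ r $ c \<noteq> 0"
proof (rule ccontr)
  assume *: "\<nexists>c. A $ r $ c \<noteq> 0"
  obtain B where "A ** B = mat 1" using assms unfolding invertible_def by blast
  then have "(A ** B) $ r $ r = 1" by (simp add: mat_def)
  then show False using * by (simp add: matrix_matrix_mult_def)
qed

definition entries_in :: "'a set \<Rightarrow> 'a ^ 'n ^ 'n::finite \<Rightarrow> bool" where
  "entries_in S A \<longleftrightarrow> (\<forall>i j. A $ i $ j \<in> S)"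

text \<open>The invertible matrices of this kind form the parabolic subgroup of the weight vector \<open>a\<close>:
  multiplying by them from the left adds to a row only multiples of rows of smaller or equal weight.\<close>

definition row_order :: "('n \<Rightarrow> real) \<Rightarrow> 'a::comm_ring_1 ^ 'n ^ 'n::finite \<Rightarrow> bool" where
  "row_order a q \<longleftrightarrow> (\<forall>r c. q $ r $ c \<noteq> 0 \<longrightarrow> a c \<le> a r)"

lemma row_order_mult:
  assumes "row_order a q" "row_order a q'" shows "row_order a (q ** q')"
  unfolding row_order_def
proof (intro allI impI)
  fix r c assume "(q ** q') $ r $ c \<noteq> 0"
  then obtain x where "q $ r $ x * q' $ x $ c \<noteq> 0"
    unfolding matrix_matrix_mult_def by (auto elim: sum.not_neutral_contains_not_neutral)
  then have "q $ r $ x \<noteq> 0" "q' $ x $ c \<noteq> 0" by auto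
  then show "a c \<le> a r" using assms unfolding row_order_def by (meson order_trans)
qed

lemma row_order_diagonal: "row_order a (diagonal d)"
  by (auto simp: row_order_def diagonal_def)

lemma row_order_shear: "(\<And>r. r \<noteq> s \<Longrightarrow> v r \<noteq> 0 \<Longrightarrow> a s \<le> a r) \<Longrightarrow> row_order a (shear v s)"
  by (auto simp: row_order_def shear_def)

context place
begin

lemma R_0: "0 \<in> R" and R_1: "1 \<in> R" and \<phi>_0: "\<phi> 0 = 0" and \<phi>_1: "\<phi> 1 = 1"
  using emb_R[of 0] emb_R[of 1] \<phi>_emb[of 0] \<phi>_emb[of 1] by (simp_all add: emb_0 emb_1)

lemma R_minus: "x \<in> R \<Longrightarrow> - x \<in> R" and \<phi>_minus: "x \<in> R \<Longrightarrow> \<phi> (- x) = - \<phi> x"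
  using R_mult[OF emb_R[of "- 1"], of x] \<phi>_mult[OF emb_R[of "- 1"], of x] \<phi>_emb[of "- 1"]
  by (simp_all add: emb_minus emb_1)

lemma R_sum: "(\<And>i. i \<in> I \<Longrightarrow> f i \<in> R) \<Longrightarrow> sum f I \<in> R"
  by (induction I rule: infinite_finite_induct) (auto intro: R_0 R_add)

lemma \<phi>_sum: "(\<And>i. i \<in> I \<Longrightarrow> f i \<in> R) \<Longrightarrow> \<phi> (sum f I) = (\<Sum>i\<in>I. \<phi> (f i))"
  by (induction I rule: infinite_finite_induct) (auto simp: \<phi>_0 \<phi>_add R_sum)

lemma R_prod: "(\<And>i. i \<in> I \<Longrightarrow> f i \<in> R) \<Longrightarrow> prod f I \<in> R"
  by (induction I rule: infinite_finite_induct) (auto intro: R_1 R_mult)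

lemma \<phi>_prod: "(\<And>i. i \<in> I \<Longrightarrow> f i \<in> R) \<Longrightarrow> \<phi> (prod f I) = (\<Prod>i\<in>I. \<phi> (f i))"
  by (induction I rule: infinite_finite_induct) (auto simp: \<phi>_1 \<phi>_mult R_prod)

lemma R_of_int: "of_int n \<in> R" and \<phi>_of_int: "\<phi> (of_int n) = of_int n"
proof -
  have emb_nat: "emb (of_nat k) = of_nat k" for k
    by (induction k) (auto simp: emb_0 emb_1 emb_add)
  have "emb (of_int n) = of_int n"
    by (cases n rule: int_cases2) (auto simp: emb_nat emb_minus)
  then show "of_int n \<in> R" "\<phi> (of_int n) = of_int n" using emb_R[of "of_int n"] \<phi>_emb[of "of_int n"] by auto
qed

text \<open>Divisibility by elements of \<open>R\<close> is a total preorder on the nonzero elements of the field.\<close>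

lemma least_valuation:
  assumes "finite X" "X \<noteq> {}" "0 \<notin> X"
  shows "\<exists>p\<in>X. \<forall>y\<in>X. y / p \<in> R"
  using assms
proof (induction X rule: finite_ne_induct)
  case (singleton x)
  then show ?case by (simp add: R_1)
next
  case (insert x X)
  then obtain p where p: "p \<in> X" "\<And>y. y \<in> X \<Longrightarrow> y / p \<in> R" by auto
  have nz: "x \<noteq> 0" "p \<noteq> 0" using insert p by auto
  show ?case
  proof (cases "x / p \<in> R")
    case True
    then show ?thesis using p by auto
  next
    case False
    then have px: "p / x \<in> R" using inverse_R[of "x / p"] by simp
    have "y / x \<in> R" if "y \<in> X" for y
      using R_mult[OF p(2)[OF that] px] nz by simp
    then show ?thesis using nz R_1 by auto
  qed
qed

definition GLR :: "'l ^ 'n ^ 'n::finite \<Rightarrow> bool" where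
  "GLR k \<longleftrightarrow> entries_in R k \<and> (\<exists>k'. entries_in R k' \<and> k ** k' = mat 1)"

lemma entries_in_R_mult: "entries_in R A \<Longrightarrow> entries_in R B \<Longrightarrow> entries_in R (A ** B)"
  by (auto simp: entries_in_def matrix_matrix_mult_def intro!: R_sum R_mult)

lemma entries_in_R_mat: "entries_in R (mat 1)"
  by (auto simp: entries_in_def mat_def R_0 R_1)

lemma GLR_mult:
  assumes "GLR A" "GLR B" shows "GLR (A ** B)"
proof -
  obtain A' B' where *: "entries_in R A'" "A ** A' = mat 1" "entries_in R B'" "B ** B' = mat 1"
    using assms unfolding GLR_def by auto
  have "(A ** B) ** (B' ** A') = A ** (B ** B') ** A'" by (simp add: matrix_mul_assoc)
  also have "\<dots> = mat 1" using * by simp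
  finally show ?thesis using assms * unfolding GLR_def by (blast intro: entries_in_R_mult)
qed

lemma GLR_invertible: "GLR k \<Longrightarrow> invertible k"
  unfolding GLR_def by (blast intro: invertible_fieldI)

lemma GLR_inverse:
  assumes "GLR k" obtains k' where "GLR k'" "k ** k' = mat 1" "k' ** k = mat 1"
  using assms matrix_left_right_inverse unfolding GLR_def by blast

lemma GLR_mat: "GLR (mat 1)"
  unfolding GLR_def using entries_in_R_mat by (metis matrix_mul_rid)

lemma GLR_exchange: "GLR (exchange i j)"
  unfolding GLR_def using exchange_exchange[of i j]
  by (auto simp: entries_in_def exchange_def R_0 R_1 intro!: exI[of _ "exchange i j"])

lemma GLR_shear:
  assumes "\<And>r. r \<noteq> s \<Longrightarrow> v r \<in> R" shows "GLR (shear v s)"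
  unfolding GLR_def
  by (intro conjI exI[of _ "shear (\<lambda>r. - v r) s"] shear_inverse)
    (auto simp: entries_in_def shear_def R_0 R_1 assms R_minus)

lemma GLR_transpose:
  assumes "GLR k" shows "GLR (transpose k)"
proof -
  obtain k' where k': "GLR k'" "k ** k' = mat 1" "k' ** k = mat 1" using GLR_inverse[OF assms] .
  then have "transpose k ** transpose k' = mat 1" by (metis matrix_transpose_mul transpose_mat)
  then show ?thesis using assms k'(1) unfolding GLR_def entries_in_def
    by (auto simp: transpose_def intro!: exI[of _ "transpose k'"])
qed

text \<open>Gaussian elimination with an entry of least valuation as pivot: all quotients by the
  pivot lie in \<open>R\<close>. In the induction, \<open>F\<close> is the set of indices not yet split off, and \<open>M\<close> is
  already diagonal outside \<open>F\<close>.\<close>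

theorem smith_form:
  fixes M :: "'l ^ 'n ^ 'n::finite"
  assumes "invertible M"
  obtains k d k' where "GLR k" "GLR k'" "M = k ** diagonal d ** k'"
proof -
  have "\<exists>k d k'. GLR k \<and> GLR k' \<and> M = k ** diagonal d ** k'"
    if "invertible M" "\<And>i j. i \<noteq> j \<Longrightarrow> i \<notin> F \<or> j \<notin> F \<Longrightarrow> M $ i $ j = 0"
    for F and M :: "'l ^ 'n ^ 'n"
    using finite[of F] that
  proof (induction F arbitrary: M rule: finite_psubset_induct)
    case (psubset F)
    show ?case
    proof (cases "F = {}")
      case True
      then have "M = diagonal (\<lambda>i. M $ i $ i)" using psubset.prems by (auto simp: vec_eq_iff diagonal_def)
      then have "M = mat 1 ** diagonal (\<lambda>i. M $ i $ i) ** mat 1" by simp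
      then show ?thesis using GLR_mat by blast
    next
      case False
      define X where "X = {M $ i $ j | i j. i \<in> F \<and> j \<in> F \<and> M $ i $ j \<noteq> 0}"
      obtain i1 where i1: "i1 \<in> F" using False by auto
      obtain j1 where j1: "M $ i1 $ j1 \<noteq> 0" using invertible_row_nonzero[OF psubset.prems(1)] by blast
      have "j1 \<in> F" using psubset.prems(2)[of i1 j1] i1 j1 by blast
      then have "X \<noteq> {}" using i1 j1 unfolding X_def by blast
      moreover have "finite X"
        by (rule finite_subset[of _ "(\<lambda>(i, j). M $ i $ j) ` UNIV"]) (auto simp: X_def)
      ultimately obtain p where pX: "p \<in> X" and pmin: "\<And>y. y \<in> X \<Longrightarrow> y / p \<in> R"
        using least_valuation[of X] unfolding X_def by auto
      obtain s t where st: "s \<in> F" "t \<in> F" "M $ s $ t = p" "p \<noteq> 0" using pX unfolding X_def by auto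
      have pR: "M $ i $ j / p \<in> R" if "i \<in> F" "j \<in> F" for i j
        using that pmin R_0 unfolding X_def by (cases "M $ i $ j = 0") auto
      define M1 where "M1 = M ** exchange s t"
      have M1: "M1 $ r $ c = M $ r $ (if c = s then t else if c = t then s else c)" for r c
        unfolding M1_def by (rule mult_exchange)
      have M1p: "M1 $ s $ s = p" using st by (simp add: M1)
      have M1R: "M1 $ i $ j / p \<in> R" if "i \<in> F" "j \<in> F" for i j using that st by (auto simp: M1 pR)
      have M10: "M1 $ i $ j = 0" if "i \<noteq> j" "i \<notin> F \<or> j \<notin> F" for i j
        using psubset.prems(2)[of i j] psubset.prems(2)[of i s] psubset.prems(2)[of i t] that st
        by (auto simp: M1)
      have M1R': "M1 $ i $ s / p \<in> R" "M1 $ s $ i / p \<in> R" for i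
        using M1R st M10[of i s] M10[of s i] R_0 by (metis div_0)+
      define v where "v r = - (M1 $ r $ s / p)" for r
      define v' where "v' c = - (M1 $ s $ c / p)" for c
      define M2 where "M2 = shear v s ** M1 ** transpose (shear v' s)"
      have M2: "M2 $ r $ c = (if r = s then if c = s then p else 0
        else if c = s then 0 else M1 $ r $ c + v r * M1 $ s $ c)" for r c
        unfolding M2_def using st(4)
        by (auto simp: mult_transpose_shear shear_mult v_def v'_def M1p)
      have GL: "GLR (exchange s t :: 'l ^ 'n ^ 'n)" "GLR (shear v s)" "GLR (transpose (shear v' s))"
        by (auto intro!: GLR_exchange GLR_shear GLR_transpose R_minus M1R' simp: v_def v'_def)
      have inv2: "invertible M2" unfolding M2_def M1_def
        by (intro invertible_mult GLR_invertible GL psubset.prems)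
      have M20: "M2 $ i $ j = 0" if "i \<noteq> j" "i \<notin> F - {s} \<or> j \<notin> F - {s}" for i j
        using that M10[of i j] M10[of i s] M10[of s j] st by (auto simp: M2 v_def)
      have "F - {s} \<subset> F" using st by auto
      then obtain k d k' where IH: "GLR k" "GLR k'" "M2 = k ** diagonal d ** k'"
        using psubset.IH[OF _ inv2 M20] by blast
      obtain E1 E2 E3 where E: "GLR E1" "exchange s t ** E1 = mat 1" "GLR E2" "E2 ** shear v s = mat 1"
        "GLR E3" "transpose (shear v' s) ** E3 = mat 1"
        using GLR_inverse[OF GL(1)] GLR_inverse[OF GL(2)] GLR_inverse[OF GL(3)] by metis
      have "E2 ** M2 ** (E3 ** E1)
          = (E2 ** shear v s) ** M ** (exchange s t ** (transpose (shear v' s) ** E3) ** E1)"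
        unfolding M2_def M1_def by (simp only: matrix_mul_assoc)
      then have "M = (E2 ** k) ** diagonal d ** (k' ** (E3 ** E1))"
        using E IH(3) by (simp add: matrix_mul_assoc)
      moreover have "GLR (E2 ** k)" "GLR (k' ** (E3 ** E1))" using E IH GLR_mult by auto
      ultimately show ?thesis by blast
    qed
  qed
  from this[of M UNIV] show ?thesis using assms that by auto
qed

text \<open>Here arbitrary operations over the field are allowed on rows, provided that they respect the
  weights, while column operations must be defined over \<open>R\<close>. The rows are processed by increasing
  weight: column operations turn the row into a multiple of a unit vector, and then multiples of
  that row clear the pivot column in the rows of larger weight. In the induction, \<open>F\<close> is the set of
  rows not yet processed.\<close>

theorem iwasawa_form:
  fixes M :: "'l ^ 'n ^ 'n::finite" and a :: "'n \<Rightarrow> real"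
  assumes "invertible M"
  obtains q k where "row_order a q" "GLR k" "q ** M = k"
proof -
  have "\<exists>q. row_order a q \<and> GLR (q ** M)"
    if "invertible M" "\<And>i j. i \<notin> F \<Longrightarrow> j \<in> F \<Longrightarrow> a i \<le> a j"
      "\<And>i j. i \<notin> F \<or> j \<notin> F \<Longrightarrow> M $ i $ j = (if i = j then 1 else 0)"
    for F and M :: "'l ^ 'n ^ 'n"
    using finite[of F] that
  proof (induction F arbitrary: M rule: finite_psubset_induct)
    case (psubset F)
    show ?case
    proof (cases "F = {}")
      case True
      then have "M = mat 1" using psubset.prems by (auto simp: vec_eq_iff mat_def)
      moreover have "row_order a (mat 1 :: 'l ^ 'n ^ 'n)" by (auto simp: row_order_def mat_def)
      ultimately show ?thesis using GLR_mat by (metis matrix_mul_lid)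
    next
      case False
      obtain s where s: "s \<in> F" "\<And>i. i \<in> F \<Longrightarrow> a s \<le> a i"
        using ex_min_if_finite[of "a ` F"] False psubset.hyps
        by (metis (no_types, lifting) finite_imageI image_iff image_is_empty linorder_not_le imageI)
      define X where "X = {M $ s $ j | j. j \<in> F \<and> M $ s $ j \<noteq> 0}"
      obtain j1 where j1: "M $ s $ j1 \<noteq> 0" using invertible_row_nonzero[OF psubset.prems(1)] by blast
      have "j1 \<in> F"
      proof (rule ccontr)
        assume "j1 \<notin> F"
        then have "s \<noteq> j1" using s by auto
        then show False using psubset.prems(3)[of s j1] \<open>j1 \<notin> F\<close> j1 by simp
      qed
      then have "X \<noteq> {}" using j1 unfolding X_def by blast
      moreover have "finite X"
        by (rule finite_subset[of _ "(\<lambda>j. M $ s $ j) ` UNIV"]) (auto simp: X_def)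
      ultimately obtain p where pX: "p \<in> X" and pmin: "\<And>y. y \<in> X \<Longrightarrow> y / p \<in> R"
        using least_valuation[of X] unfolding X_def by auto
      obtain t where t: "t \<in> F" "M $ s $ t = p" "p \<noteq> 0" using pX unfolding X_def by auto
      define M1 where "M1 = M ** exchange s t"
      have M1: "M1 $ r $ c = M $ r $ (if c = s then t else if c = t then s else c)" for r c
        unfolding M1_def by (rule mult_exchange)
      have M1p: "M1 $ s $ s = p" using t by (simp add: M1)
      have M10: "M1 $ i $ j = (if i = j then 1 else 0)" if "i \<notin> F \<or> j \<notin> F" for i j
        using psubset.prems(3)[of i j] psubset.prems(3)[of i s] psubset.prems(3)[of i t] that s t
        by (auto simp: M1)
      have MR: "M $ s $ j / p \<in> R" if "j \<in> F" for j
        using that pmin R_0 unfolding X_def by (cases "M $ s $ j = 0") auto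
      have pR: "M1 $ s $ j / p \<in> R" for j
      proof (cases "j \<in> F")
        case True
        then show ?thesis using MR s(1) t(1) by (simp add: M1)
      next
        case False
        then have "M1 $ s $ j = 0" using M10[of s j] s(1) by auto
        then show ?thesis by (simp add: R_0)
      qed
      define v' where "v' c = - (M1 $ s $ c / p)" for c
      define M2 where "M2 = M1 ** transpose (shear v' s)"
      have M2: "M2 $ r $ c = (if c = s then M1 $ r $ s else M1 $ r $ c + M1 $ r $ s * v' c)" for r c
        unfolding M2_def by (auto simp: mult_transpose_shear)
      have M2s: "M2 $ s $ c = (if c = s then p else 0)" for c
        using t(3) by (auto simp: M2 M1p v'_def)
      have M20: "M2 $ i $ j = (if i = j then 1 else 0)" if "i \<notin> F \<or> j \<notin> F" for i j
        using that M10[of i j] M10[of i s] M10[of s j] s(1)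
        by (cases "i = s") (auto simp: M2 v'_def)
      define d where "d r = (if r = s then inverse p else 1)" for r
      define v where "v r = - M2 $ r $ s" for r
      define M3 where "M3 = shear v s ** (diagonal d ** M2)"
      have M3: "M3 $ r $ c = (if r = s \<or> c = s then if r = c then 1 else 0 else M2 $ r $ c)" for r c
        unfolding M3_def using t(3) by (auto simp: shear_mult diagonal_mult d_def v_def M2s)
      have GL: "GLR (exchange s t :: 'l ^ 'n ^ 'n)" "GLR (transpose (shear v' s))"
        by (auto intro!: GLR_exchange GLR_shear GLR_transpose R_minus pR simp: v'_def)
      have "invertible (shear v s)" by (rule invertible_fieldI[OF shear_inverse])
      moreover have "invertible (diagonal d)"
        by (rule invertible_fieldI[OF diagonal_inverse]) (use t in \<open>auto simp: d_def\<close>)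
      ultimately have inv3: "invertible M3" unfolding M3_def M2_def M1_def
        by (intro invertible_mult GL[THEN GLR_invertible] psubset.prems)
      have low: "a i \<le> a j" if "i \<notin> F - {s}" "j \<in> F - {s}" for i j
        using that psubset.prems(2) s by blast
      have M30: "M3 $ i $ j = (if i = j then 1 else 0)" if "i \<notin> F - {s} \<or> j \<notin> F - {s}" for i j
        using that M20[of i j] by (auto simp: M3)
      have "F - {s} \<subset> F" using s by auto
      then obtain q where q: "row_order a q" "GLR (q ** M3)"
        using psubset.IH[OF _ inv3 low M30] by blast
      obtain E1 E2 where E: "GLR E1" "exchange s t ** E1 = mat 1"
        "GLR E2" "transpose (shear v' s) ** E2 = mat 1"
        using GLR_inverse[OF GL(1)] GLR_inverse[OF GL(2)] by metis
      define q' where "q' = q ** (shear v s ** diagonal d)"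
      have "q ** M3 ** (E2 ** E1)
          = q' ** M ** (exchange s t ** (transpose (shear v' s) ** E2) ** E1)"
        unfolding M3_def M2_def M1_def q'_def by (simp only: matrix_mul_assoc)
      then have "q' ** M = q ** M3 ** (E2 ** E1)" using E by simp
      then have "GLR (q' ** M)" using q(2) E GLR_mult by metis
      moreover have "a s \<le> a r" if "r \<noteq> s" "v r \<noteq> 0" for r
        using that M20[of r s] s by (cases "r \<in> F") (auto simp: v_def)
      then have "row_order a q'" unfolding q'_def
        by (intro row_order_mult q row_order_shear row_order_diagonal)
      ultimately show ?thesis by blast
    qed
  qed
  from this[of M UNIV] show ?thesis using assms that by auto
qed

end

section \<open>Tensors under a triple of matrices\<close>

text \<open>The action of \<open>tensor_act\<close> over an arbitrary commutative ring; besides \<open>\<complex>\<close>, polynomial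
  functions and their quotients are needed.\<close>

definition act :: "'a ^ 'm ^ 'm \<Rightarrow> 'a ^ 'm ^ 'm \<Rightarrow> 'a ^ 'm ^ 'm \<Rightarrow> 'a::comm_ring_1 ^ 'm ^ 'm ^ 'm::finite \<Rightarrow> 'a ^ 'm ^ 'm ^ 'm" where
  "act A B C w = (\<chi> i j k. \<Sum>a\<in>UNIV. \<Sum>b\<in>UNIV. \<Sum>c\<in>UNIV. A $ i $ a * B $ j $ b * C $ k $ c * w $ a $ b $ c)"

lemma tensor_act_eq_act: "tensor_act (A, B, C) w = act A B C w"
  by (simp add: tensor_act_def act_def)

text \<open>The actions on the single tensor factors commute, which turns statements about the triple
  action into statements about one matrix product.\<close>

definition mode1 :: "'a ^ 'm ^ 'm \<Rightarrow> 'a::comm_ring_1 ^ 'm ^ 'm ^ 'm::finite \<Rightarrow> 'a ^ 'm ^ 'm ^ 'm" where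
  "mode1 A w = (\<chi> i j k. \<Sum>a\<in>UNIV. A $ i $ a * w $ a $ j $ k)"
definition mode2 :: "'a ^ 'm ^ 'm \<Rightarrow> 'a::comm_ring_1 ^ 'm ^ 'm ^ 'm::finite \<Rightarrow> 'a ^ 'm ^ 'm ^ 'm" where
  "mode2 A w = (\<chi> i j k. \<Sum>a\<in>UNIV. A $ j $ a * w $ i $ a $ k)"
definition mode3 :: "'a ^ 'm ^ 'm \<Rightarrow> 'a::comm_ring_1 ^ 'm ^ 'm ^ 'm::finite \<Rightarrow> 'a ^ 'm ^ 'm ^ 'm" where
  "mode3 A w = (\<chi> i j k. \<Sum>a\<in>UNIV. A $ k $ a * w $ i $ j $ a)"

lemma act_modes: "act A B C w = mode1 A (mode2 B (mode3 C w))"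
  by (simp add: vec_eq_iff act_def mode1_def mode2_def mode3_def sum_distrib_left mult.assoc)

lemma mode1_mode1: "mode1 A (mode1 B w) = mode1 (A ** B) w"
  unfolding vec_eq_iff mode1_def matrix_matrix_mult_def
  by (auto simp: sum_distrib_left sum_distrib_right mult.assoc intro: sum.swap)

lemma mode2_mode2: "mode2 A (mode2 B w) = mode2 (A ** B) w"
  unfolding vec_eq_iff mode2_def matrix_matrix_mult_def
  by (auto simp: sum_distrib_left sum_distrib_right mult.assoc intro: sum.swap)

lemma mode3_mode3: "mode3 A (mode3 B w) = mode3 (A ** B) w"
  unfolding vec_eq_iff mode3_def matrix_matrix_mult_def
  by (auto simp: sum_distrib_left sum_distrib_right mult.assoc intro: sum.swap)

lemma mode2_mode1: "mode2 A (mode1 B w) = mode1 B (mode2 A w)"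
  unfolding vec_eq_iff mode1_def mode2_def
  by (auto simp: sum_distrib_left mult.left_commute intro: sum.swap)

lemma mode3_mode1: "mode3 A (mode1 B w) = mode1 B (mode3 A w)"
  unfolding vec_eq_iff mode1_def mode3_def
  by (auto simp: sum_distrib_left mult.left_commute intro: sum.swap)

lemma mode3_mode2: "mode3 A (mode2 B w) = mode2 B (mode3 A w)"
  unfolding vec_eq_iff mode2_def mode3_def
  by (auto simp: sum_distrib_left mult.left_commute intro: sum.swap)

lemma act_act: "act A B C (act A' B' C' w) = act (A ** A') (B ** B') (C ** C') w"
  unfolding act_modes
  by (simp only: mode3_mode1 mode3_mode2 mode2_mode1 mode1_mode1[symmetric] mode2_mode2[symmetric]
      mode3_mode3[symmetric])

lemma act_mat1: "act (mat 1) (mat 1) (mat 1) w = w"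
  by (simp add: act_modes mode1_def mode2_def mode3_def mat_def vec_eq_iff if_distrib[of "\<lambda>x. x * _"] cong: if_cong)

lemma act_diagonal:
  "act (diagonal d) (diagonal e) (diagonal f) w $ i $ j $ k = d i * e j * f k * w $ i $ j $ k"
  by (simp add: act_modes mode1_def mode2_def mode3_def diagonal_def if_distrib[of "\<lambda>x. x * _"] mult.assoc cong: if_cong)

lemma act_nonzero_term:
  assumes "act A B C w $ i $ j $ k \<noteq> 0"
  obtains a b c where "A $ i $ a \<noteq> 0" "B $ j $ b \<noteq> 0" "C $ k $ c \<noteq> 0" "w $ a $ b $ c \<noteq> 0"
proof -
  obtain a b c where "A $ i $ a * B $ j $ b * C $ k $ c * w $ a $ b $ c \<noteq> 0"
    using assms unfolding act_def by (auto elim!: sum.not_neutral_contains_not_neutral)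
  then show ?thesis using that[of a b c] by (metis mult_zero_left mult_zero_right)
qed

definition map_mat :: "('a \<Rightarrow> 'b) \<Rightarrow> 'a ^ 'm ^ 'm::finite \<Rightarrow> 'b ^ 'm ^ 'm" where
  "map_mat f A = (\<chi> i j. f (A $ i $ j))"

definition map_ten :: "('a \<Rightarrow> 'b) \<Rightarrow> 'a ^ 'm ^ 'm ^ 'm::finite \<Rightarrow> 'b ^ 'm ^ 'm ^ 'm" where
  "map_ten f w = (\<chi> i j k. f (w $ i $ j $ k))"

lemma map_entry [simp]: "map_mat f A $ i $ j = f (A $ i $ j)" "map_ten f w $ i $ j $ k = f (w $ i $ j $ k)"
  by (simp_all add: map_mat_def map_ten_def)

lemma evaluate_act: "evaluate (act A B C w $ i $ j $ k) x
    = act (map_mat (\<lambda>f. evaluate f x) A) (map_mat (\<lambda>f. evaluate f x) B) (map_mat (\<lambda>f. evaluate f x) C)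
        (map_ten (\<lambda>f. evaluate f x) w) $ i $ j $ k"
  by (simp add: act_def)

lemma evaluate_det: "evaluate (det A) x = det (map_mat (\<lambda>f. evaluate f x) A)"
  by (simp add: det_def)

definition incl :: "'v polyfun \<Rightarrow> 'v polyfun fract" where "incl f = Fract f 1"

lemma incl_simps [simp]:
  "incl 0 = 0" "incl 1 = 1" "incl (f + g) = incl f + incl g" "incl (f * g) = incl f * incl g"
  "incl (- f) = - incl f" "incl f = 0 \<longleftrightarrow> f = 0"
  by (simp_all add: incl_def Zero_fract_def One_fract_def eq_fract)

lemma incl_sum [simp]: "incl (sum f I) = (\<Sum>i\<in>I. incl (f i))"
  by (induction I rule: infinite_finite_induct) auto

lemma incl_prod [simp]: "incl (prod f I) = (\<Prod>i\<in>I. incl (f i))"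
  by (induction I rule: infinite_finite_induct) auto

lemma incl_of_int [simp]: "incl (of_int n) = of_int n"
proof -
  have *: "incl (of_nat n) = of_nat n" for n by (induction n) auto
  show ?thesis by (cases n rule: int_cases2) (auto simp: *)
qed

lemma incl_act: "incl (act A B C w $ i $ j $ k)
    = act (map_mat incl A) (map_mat incl B) (map_mat incl C) (map_ten incl w) $ i $ j $ k"
  by (simp add: act_def)

lemma incl_det: "incl (det A) = det (map_mat incl A)"
  by (simp add: det_def)

lemma Fract_incl: "g \<noteq> 0 \<Longrightarrow> Fract f g = incl f / incl g"
  by (simp add: incl_def)

lemma const_fract_incl: "const_fract c = incl (Const c)"
  by (simp add: const_fract_def incl_def)

context place
begin

definition ten_in_R :: "'l ^ 'm ^ 'm ^ 'm::finite \<Rightarrow> bool" where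
  "ten_in_R w \<longleftrightarrow> (\<forall>i j k. w $ i $ j $ k \<in> R)"

lemma ten_in_R_act:
  "entries_in R A \<Longrightarrow> entries_in R B \<Longrightarrow> entries_in R C \<Longrightarrow> ten_in_R w \<Longrightarrow> ten_in_R (act A B C w)"
  by (auto simp: entries_in_def ten_in_R_def act_def intro!: R_sum R_mult)

lemma \<phi>_act:
  assumes "entries_in R A" "entries_in R B" "entries_in R C" "ten_in_R w"
  shows "map_ten \<phi> (act A B C w) = act (map_mat \<phi> A) (map_mat \<phi> B) (map_mat \<phi> C) (map_ten \<phi> w)"
  using assms by (auto simp: vec_eq_iff entries_in_def ten_in_R_def act_def \<phi>_sum \<phi>_mult R_sum R_mult)

lemma det_in_R: "entries_in R A \<Longrightarrow> det A \<in> R"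
  by (auto simp: det_def entries_in_def intro!: R_sum R_mult R_prod R_of_int)

lemma \<phi>_det: "entries_in R A \<Longrightarrow> \<phi> (det A) = det (map_mat \<phi> A)"
  by (auto simp: det_def entries_in_def \<phi>_sum \<phi>_mult \<phi>_prod R_mult R_prod R_of_int \<phi>_of_int)

lemma GLR_det:
  assumes "GLR k" shows "det k \<in> R" "inverse (det k) \<in> R"
proof -
  obtain k' where k': "GLR k'" "k ** k' = mat 1" using GLR_inverse[OF assms] by metis
  then have "det k * det k' = 1" by (metis det_I det_mul)
  then have "inverse (det k) = det k'" by (rule inverse_unique)
  then show "det k \<in> R" "inverse (det k) \<in> R" using assms k'(1) det_in_R by (auto simp: GLR_def)
qed

lemma GLR_reduction:
  assumes "GLR k" shows "invertible (map_mat \<phi> k)"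
proof -
  have "\<phi> (det k * inverse (det k)) = \<phi> (det k) * \<phi> (inverse (det k))"
    using GLR_det[OF assms] by (rule \<phi>_mult)
  moreover have "det k \<noteq> 0" using GLR_invertible[OF assms] by (simp add: invertible_det_nz)
  ultimately have "\<phi> (det k) \<noteq> 0" using \<phi>_1 by auto
  then show ?thesis using assms by (simp add: invertible_det_nz \<phi>_det GLR_def)
qed

end

section \<open>Real-valued valuations\<close>

context place
begin

text \<open>The elements whose valuation lies between two multiples of the valuation of \<open>x\<close>. On these the
  valuation can be compared with real multiples of the valuation of \<open>x\<close>.\<close>

definition commensurable :: "'l \<Rightarrow> 'l set" where
  "commensurable x = {y. y \<noteq> 0 \<and> (\<exists>n. y * x ^ n \<in> R \<and> inverse y * x ^ n \<in> R)}"

lemma commensurable_mult: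
  assumes "y \<in> commensurable x" "z \<in> commensurable x"
  shows "y * z \<in> commensurable x"
proof -
  obtain n m where *: "y * x ^ n \<in> R" "inverse y * x ^ n \<in> R" "z * x ^ m \<in> R" "inverse z * x ^ m \<in> R"
    using assms unfolding commensurable_def by auto
  have "y * z * x ^ (n + m) = (y * x ^ n) * (z * x ^ m)"
    "inverse (y * z) * x ^ (n + m) = (inverse y * x ^ n) * (inverse z * x ^ m)"
    by (simp_all add: power_add)
  then have "y * z * x ^ (n + m) \<in> R" "inverse (y * z) * x ^ (n + m) \<in> R"
    using R_mult * by metis+
  then show ?thesis using assms unfolding commensurable_def by auto
qed

lemma commensurable_inverse: "y \<in> commensurable x \<Longrightarrow> inverse y \<in> commensurable x"
  unfolding commensurable_def by auto

lemma commensurable_1: "1 \<in> commensurable x"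
  unfolding commensurable_def using R_1 by (auto intro: exI[of _ 0])

lemma commensurable_prod: "(\<And>i. i \<in> I \<Longrightarrow> f i \<in> commensurable x) \<Longrightarrow> prod f I \<in> commensurable x"
  by (induction I rule: infinite_finite_induct) (auto intro: commensurable_1 commensurable_mult)

lemma R_power: "x \<in> R \<Longrightarrow> x ^ n \<in> R"
  by (induction n) (auto intro: R_1 R_mult)

lemma \<phi>_power: "x \<in> R \<Longrightarrow> \<phi> (x ^ n) = \<phi> x ^ n"
  by (induction n) (auto simp: \<phi>_1 \<phi>_mult R_power)

text \<open>The value group of a place need not embed into the reals. But on the elements commensurable with
  \<open>x\<close>, comparing powers of \<open>y\<close> with powers of \<open>x\<close> defines a monotone homomorphism to the reals,
  as in Hoelder's theorem on Archimedean ordered groups: \<open>\<nu> y\<close> is the supremum of the \<open>p/q\<close> such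
  that \<open>y\<^sup>q\<close> has at least the valuation of \<open>x\<^sup>p\<close>.\<close>

theorem real_valuation:
  assumes x: "x \<in> R" "\<phi> x = 0" "x \<noteq> 0"
  obtains \<nu> :: "'l \<Rightarrow> real" where "\<nu> x = 1"
    "\<And>y z. y \<in> commensurable x \<Longrightarrow> z \<in> commensurable x \<Longrightarrow> \<nu> (y * z) = \<nu> y + \<nu> z"
    "\<And>y. y \<in> commensurable x \<Longrightarrow> y \<in> R \<Longrightarrow> \<nu> y \<ge> 0"
proof -
  have xpos: "x powi p \<in> R" if "p \<ge> 0" for p
    using that R_power[OF x(1)] by (simp add: power_int_def)
  have xneg: "p \<ge> 0" if "x powi p \<in> R" for p
  proof (rule ccontr)
    assume "\<not> p \<ge> 0"
    then have n: "nat (- p) > 0" by simp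
    have "1 = x powi p * x ^ nat (- p)" using \<open>\<not> p \<ge> 0\<close> x(3) by (simp add: power_int_def field_simps)
    also have "\<phi> \<dots> = 0" using that n x by (simp add: \<phi>_mult \<phi>_power R_power)
    finally show False by (simp add: \<phi>_1)
  qed
  define S where "S y = {(of_int p / of_nat q :: real) | p q. q > 0 \<and> y ^ q * x powi (- p) \<in> R}" for y :: 'l
  have SI: "of_int p / of_nat q \<in> S y" if "q > 0" "y ^ q * x powi (- p) \<in> R" for p q y
    using that unfolding S_def by blast
  define \<nu> where "\<nu> y = (Sup (S y) :: real)" for y
  have ne: "S y \<noteq> {}" if y: "y \<in> commensurable x" for y
  proof -
    obtain n where "y * x ^ n \<in> R" using y unfolding commensurable_def by auto
    then have "of_int (- int n) / of_nat 1 \<in> S y" by (intro SI) auto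
    then show ?thesis by blast
  qed
  have bdd: "bdd_above (S y)" if y: "y \<in> commensurable x" for y
  proof -
    obtain n where n: "inverse y * x ^ n \<in> R" and y0: "y \<noteq> 0" using y unfolding commensurable_def by auto
    have "r \<le> of_nat n" if r: "r \<in> S y" for r
    proof -
      obtain p q where pq: "r = of_int p / of_nat q" "q > 0" "y ^ q * x powi (- p) \<in> R"
        using r unfolding S_def by auto
      have "(y ^ q * x powi (- p)) * (inverse y * x ^ n) ^ q \<in> R" by (intro R_mult R_power pq n)
      also have "(y ^ q * x powi (- p)) * (inverse y * x ^ n) ^ q = x powi (- p) * x powi (int (n * q))"
      proof -
        have "x powi (int (n * q)) = (x ^ n) ^ q" by (simp only: power_int_of_nat power_mult)
        then show ?thesis using y0 by (simp add: power_mult_distrib power_inverse)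
      qed
      also have "\<dots> = x powi (int (n * q) - p)" using x(3) by (simp flip: power_int_add)
      finally have "int (n * q) - p \<ge> 0" by (rule xneg)
      then have "real_of_int p \<le> real n * real q" by (metis diff_ge_0_iff_ge of_int_le_iff of_int_of_nat_eq of_nat_mult)
      then show ?thesis unfolding pq(1) using pq(2) by (simp add: pos_divide_le_eq)
    qed
    then show ?thesis by (rule bdd_aboveI)
  qed
  have upper: "r \<le> \<nu> y" if "y \<in> commensurable x" "r \<in> S y" for y r
    unfolding \<nu>_def using cSup_upper[OF that(2) bdd[OF that(1)]] .
  have least: "\<nu> y \<le> b" if "y \<in> commensurable x" "\<And>r. r \<in> S y \<Longrightarrow> r \<le> b" for y b
    unfolding \<nu>_def using cSup_least[OF ne[OF that(1)]] that(2) by blast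
  have sup_add: "\<nu> y + \<nu> z \<le> \<nu> (y * z)" if yz: "y \<in> commensurable x" "z \<in> commensurable x" for y z
  proof -
    have 1: "r + s \<le> \<nu> (y * z)" if rs: "r \<in> S y" "s \<in> S z" for r s
    proof -
      obtain p q where pq: "r = of_int p / of_nat q" "q > 0" "y ^ q * x powi (- p) \<in> R"
        using rs unfolding S_def by auto
      obtain p' q' where pq': "s = of_int p' / of_nat q'" "q' > 0" "z ^ q' * x powi (- p') \<in> R"
        using rs unfolding S_def by auto
      have "(y ^ q * x powi (- p)) ^ q' * (z ^ q' * x powi (- p')) ^ q \<in> R"
        by (intro R_mult R_power pq pq')
      also have "(y ^ q * x powi (- p)) ^ q' * (z ^ q' * x powi (- p')) ^ q
          = (y * z) ^ (q * q') * (x powi (- p * int q') * x powi (- p' * int q))"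
      proof -
        have "x powi (- p * int q') = (x powi (- p)) ^ q'" "x powi (- p' * int q) = (x powi (- p')) ^ q"
          by (simp_all only: power_int_mult power_int_of_nat)
        moreover have "(y ^ q) ^ q' = y ^ (q * q')" "(z ^ q') ^ q = z ^ (q * q')"
          by (simp_all only: power_mult[symmetric] mult.commute)
        ultimately show ?thesis by (simp only: power_mult_distrib mult_ac)
      qed
      also have "x powi (- p * int q') * x powi (- p' * int q) = x powi (- (p * int q' + p' * int q))"
        using x(3) by (simp flip: power_int_add)
      finally have "of_int (p * int q' + p' * int q) / of_nat (q * q') \<in> S (y * z)"
        using pq pq' by (intro SI) auto
      also have "of_int (p * int q' + p' * int q) / of_nat (q * q') = r + s"
        unfolding pq(1) pq'(1) using pq(2) pq'(2) by (simp add: add_frac_eq)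
      finally show ?thesis using upper commensurable_mult yz by blast
    qed
    have "\<nu> z \<le> \<nu> (y * z) - r" if "r \<in> S y" for r
      by (rule least[OF yz(2)]) (use 1[OF that] in \<open>simp add: algebra_simps\<close>)
    then have "\<nu> y \<le> \<nu> (y * z) - \<nu> z" by (intro least[OF yz(1)]) (simp add: algebra_simps)
    then show ?thesis by simp
  qed
  have one: "\<nu> 1 \<le> 0"
  proof (rule least[OF commensurable_1])
    fix r assume "r \<in> S 1"
    then obtain p q where "r = of_int p / of_nat q" "q > 0" "x powi (- p) \<in> R" unfolding S_def by auto
    then show "r \<le> 0" using xneg[of "- p"] by (simp add: divide_nonpos_pos)
  qed
  have inv: "- \<nu> y \<le> \<nu> (inverse y)" if y: "y \<in> commensurable x" for y
  proof (rule ccontr)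
    assume "\<not> ?thesis"
    then obtain t where t: "\<nu> y < of_rat t" "of_rat t < - \<nu> (inverse y)"
      using of_rat_dense[of "\<nu> y" "- \<nu> (inverse y)"] by auto
    obtain p q where pq: "t = Rat.Fract p q" "q > 0" by (cases t) auto
    define n where "n = nat q"
    have tn: "of_rat t = (of_int p / of_nat n :: real)" "n > 0" using pq by (simp_all add: of_rat_rat n_def)
    have y0: "y \<noteq> 0" using y by (simp add: commensurable_def)
    have "y ^ n * x powi (- p) \<notin> R" using upper[OF y SI[of n y p]] tn t by auto
    then have "inverse (y ^ n * x powi (- p)) \<in> R" by (rule inverse_R)
    also have "inverse (y ^ n * x powi (- p)) = inverse y ^ n * x powi (- (- p))"
      by (simp add: power_int_minus power_inverse)
    finally have "of_int (- p) / of_nat n \<le> \<nu> (inverse y)"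
      using upper[OF commensurable_inverse[OF y] SI[of n "inverse y" "- p"]] tn by simp
    then show False using tn t by simp
  qed
  have "\<nu> (inverse y) = - \<nu> y" if y: "y \<in> commensurable x" for y
    using inv[OF y] sup_add[OF y commensurable_inverse[OF y]] one y by (simp add: commensurable_def)
  then have add: "\<nu> (y * z) = \<nu> y + \<nu> z" if "y \<in> commensurable x" "z \<in> commensurable x" for y z
    using sup_add[OF that] sup_add[OF that[THEN commensurable_inverse]] that commensurable_mult[OF that]
    by (simp flip: inverse_mult_distrib)
  have xc: "x \<in> commensurable x"
    unfolding commensurable_def using x by (auto intro!: exI[of _ 1] simp: R_1 R_mult)
  have "\<nu> x \<le> 1"
  proof (rule least[OF xc])
    fix r assume "r \<in> S x"
    then obtain p q where *: "r = of_int p / of_nat q" "q > 0" "x ^ q * x powi (- p) \<in> R" unfolding S_def by auto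
    have "x ^ q * x powi (- p) = x powi (int q - p)" using x(3) by (simp add: power_int_add[of x "int q" "- p", simplified])
    then have "int q - p \<ge> 0" using xneg *(3) by metis
    then have "real_of_int p \<le> real q" by linarith
    then show "r \<le> 1" unfolding *(1) using *(2) by (simp add: pos_divide_le_eq)
  qed
  moreover have "of_int 1 / of_nat 1 \<in> S x" by (rule SI) (use x R_1 in \<open>auto simp: power_int_minus\<close>)
  then have "1 \<le> \<nu> x" using upper[OF xc] by fastforce
  ultimately have "\<nu> x = 1" by simp
  moreover have "\<nu> y \<ge> 0" if "y \<in> commensurable x" "y \<in> R" for y
    using upper[OF that(1) SI[of 1 y 0]] that by simp
  ultimately show ?thesis using that add by blast
qed

end

section \<open>Stability and closed orbits\<close>

lemma zariski_closedI:
  assumes "\<And>v. (\<And>P. polynomial_fun P \<Longrightarrow> (\<And>w. w \<in> S \<Longrightarrow> P w = 0) \<Longrightarrow> P v = 0) \<Longrightarrow> v \<in> S"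
  shows "zariski_closed S"
  unfolding zariski_closed_def
  by (rule exI[of _ "{P. polynomial_fun P \<and> (\<forall>w\<in>S. P w = 0)}"]) (use assms in blast)

lemma zariski_closed_empty: "zariski_closed {}"
  unfolding zariski_closed_def by (rule exI[of _ "{\<lambda>_. 1}"]) (auto intro: polynomial_fun.const)

lemma zariski_closed_Un:
  assumes "zariski_closed S" "zariski_closed T" shows "zariski_closed (S \<union> T)"
proof -
  obtain F G where F: "\<forall>f\<in>F. polynomial_fun f" "S = {w. \<forall>f\<in>F. f w = 0}"
    and G: "\<forall>f\<in>G. polynomial_fun f" "T = {w. \<forall>f\<in>G. f w = 0}"
    using assms unfolding zariski_closed_def by auto
  define H where "H = {(\<lambda>w. f w * g w) | f g. f \<in> F \<and> g \<in> G}"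
  have "\<forall>h\<in>H. polynomial_fun h" using F G unfolding H_def by (auto intro: polynomial_fun.mult)
  moreover have "S \<union> T = {w. \<forall>h\<in>H. h w = 0}"
  proof (intro set_eqI iffI)
    fix w assume "w \<in> S \<union> T" then show "w \<in> {w. \<forall>h\<in>H. h w = 0}" using F G unfolding H_def by auto
  next
    fix w assume w: "w \<in> {w. \<forall>h\<in>H. h w = 0}"
    show "w \<in> S \<union> T"
    proof (rule ccontr)
      assume "w \<notin> S \<union> T"
      then obtain f g where "f \<in> F" "f w \<noteq> 0" "g \<in> G" "g w \<noteq> 0" using F G by auto
      then show False using w unfolding H_def by fastforce
    qed
  qed
  ultimately show ?thesis unfolding zariski_closed_def by blast
qed

lemma zariski_closed_UN:
  "finite I \<Longrightarrow> (\<And>i. i \<in> I \<Longrightarrow> zariski_closed (S i)) \<Longrightarrow> zariski_closed (\<Union>i\<in>I. S i)"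
  by (induction I rule: finite_induct) (auto intro: zariski_closed_empty zariski_closed_Un)

text \<open>The logarithms of a nontrivial diagonal one-parameter subgroup of \<open>SL\<^sub>m\<^sup>3\<close>, with real instead of
  integral weights.\<close>

definition one_parameter_weights :: "('m::finite \<Rightarrow> real) \<Rightarrow> ('m \<Rightarrow> real) \<Rightarrow> ('m \<Rightarrow> real) \<Rightarrow> bool" where
  "one_parameter_weights a b c \<longleftrightarrow> (\<Sum>i\<in>UNIV. a i) = 0 \<and> (\<Sum>i\<in>UNIV. b i) = 0 \<and> (\<Sum>i\<in>UNIV. c i) = 0 \<and>
     (\<exists>i. a i \<noteq> 0 \<or> b i \<noteq> 0 \<or> c i \<noteq> 0)"

text \<open>Using \<open>GL\<^sub>m\<close> in place of \<open>SL\<^sub>m\<close> spares normalising determinants and gives the same condition,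
  since scaling does not change the support of a tensor.\<close>

definition movable_into :: "('m \<times> 'm \<times> 'm) set \<Rightarrow> 'm::finite tensor3 \<Rightarrow> bool" where
  "movable_into S w \<longleftrightarrow> (\<exists>g h l. invertible g \<and> invertible h \<and> invertible l \<and>
     (\<forall>i j k. act g h l w $ i $ j $ k \<noteq> 0 \<longrightarrow> (i, j, k) \<in> S))"

definition nonneg_support :: "('m \<Rightarrow> real) \<Rightarrow> ('m \<Rightarrow> real) \<Rightarrow> ('m \<Rightarrow> real) \<Rightarrow> ('m \<times> 'm \<times> 'm) set" where
  "nonneg_support a b c = {(i, j, k). 0 \<le> a i + b j + c k}"

text \<open>This is the criterion of Hilbert and Mumford turned into a definition: for no base change and no
  nontrivial one-parameter subgroup does the tensor stay bounded along the subgroup.\<close>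

definition stable :: "'m::finite tensor3 \<Rightarrow> bool" where
  "stable w \<longleftrightarrow> (\<forall>a b c. one_parameter_weights a b c \<longrightarrow> \<not> movable_into (nonneg_support a b c) w)"

context place
begin

text \<open>The properness of the orbit map of a stable tensor, in valuative form. In a Smith decomposition
  \<open>g = k d k'\<close>, the tensor \<open>d k' w\<close> is defined over \<open>R\<close>, so that the entries of \<open>k' w\<close> at which \<open>d\<close> has
  negative valuation reduce to 0. If the entries of \<open>d\<close> are not all units, their real valuations
  are weights that destabilise \<open>w\<close>. The weights have sum zero because the product of the entries
  of \<open>d\<close> differs from \<open>det g = 1\<close> by a unit.\<close>

lemma bounded_orbit_point:
  fixes w :: "'m::finite tensor3"
  assumes st: "stable w"
    and g: "det g = 1" "det h = 1" "det l = 1"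
    and bounded: "ten_in_R (act g h l (map_ten emb w))"
  shows "entries_in R g \<and> entries_in R h \<and> entries_in R l"
proof -
  have inv: "invertible g" "invertible h" "invertible l" using g by (auto simp: invertible_det_nz)
  obtain k1 d1 k1' where g1: "GLR k1" "GLR k1'" "g = k1 ** diagonal d1 ** k1'" by (rule smith_form[OF inv(1)])
  obtain k2 d2 k2' where g2: "GLR k2" "GLR k2'" "h = k2 ** diagonal d2 ** k2'" by (rule smith_form[OF inv(2)])
  obtain k3 d3 k3' where g3: "GLR k3" "GLR k3'" "l = k3 ** diagonal d3 ** k3'" by (rule smith_form[OF inv(3)])
  define y where "y = act k1' k2' k3' (map_ten emb w)"
  have Rw: "ten_in_R (map_ten emb w)" by (simp add: ten_in_R_def emb_R)
  have kR: "entries_in R k1'" "entries_in R k2'" "entries_in R k3'" using g1 g2 g3 by (auto simp: GLR_def)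
  have yR: "y $ i $ j $ k \<in> R" for i j k
    using ten_in_R_act[OF kR Rw] by (simp add: y_def ten_in_R_def)
  have "map_ten \<phi> (map_ten emb w) = w" by (simp add: vec_eq_iff \<phi>_emb)
  then have \<phi>y: "map_ten \<phi> y = act (map_mat \<phi> k1') (map_mat \<phi> k2') (map_mat \<phi> k3') w"
    using \<phi>_act[OF kR Rw] by (simp add: y_def)
  obtain m1 m2 m3 where m: "GLR m1" "GLR m2" "GLR m3" "m1 ** k1 = mat 1" "m2 ** k2 = mat 1" "m3 ** k3 = mat 1"
    using GLR_inverse[OF g1(1)] GLR_inverse[OF g2(1)] GLR_inverse[OF g3(1)] by metis
  have "m1 ** g = diagonal d1 ** k1'" "m2 ** h = diagonal d2 ** k2'" "m3 ** l = diagonal d3 ** k3'"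
    unfolding g1(3) g2(3) g3(3) using m by (simp_all add: matrix_mul_assoc)
  then have "act m1 m2 m3 (act g h l (map_ten emb w)) = act (diagonal d1) (diagonal d2) (diagonal d3) y"
    by (simp add: act_act y_def)
  moreover have "ten_in_R (act m1 m2 m3 (act g h l (map_ten emb w)))"
    using m by (intro ten_in_R_act bounded) (auto simp: GLR_def)
  ultimately have dy: "d1 i * d2 j * d3 k * y $ i $ j $ k \<in> R" for i j k
    unfolding ten_in_R_def by (metis act_diagonal)
  have prod_unit: "(\<Prod>i\<in>UNIV. d i) \<in> R \<and> inverse (\<Prod>i\<in>UNIV. d i) \<in> R \<and> (\<forall>i. d i \<noteq> 0)"
    if "det G = 1" "G = k ** diagonal d ** k'" "GLR k" "GLR k'" for G k k' :: "'l ^ 'm ^ 'm" and d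
  proof -
    have 1: "det k * (\<Prod>i\<in>UNIV. d i) * det k' = 1"
      using that by (simp add: det_mul det_diagonal diagonal_def)
    then have nz: "det k \<noteq> 0" "det k' \<noteq> 0" "(\<Prod>i\<in>UNIV. d i) \<noteq> 0"
      by (metis mult_zero_left mult_zero_right zero_neq_one)+
    have "(\<Prod>i\<in>UNIV. d i) = inverse (det k) * inverse (det k')"
      "inverse (\<Prod>i\<in>UNIV. d i) = det k * det k'" using 1 nz by (auto simp: field_simps)
    moreover have "\<forall>i. d i \<noteq> 0" using nz(3) by simp
    ultimately show ?thesis using GLR_det[OF that(3)] GLR_det[OF that(4)] by (simp add: R_mult)
  qed
  note pu = prod_unit[OF g(1) g1(3,1,2)] prod_unit[OF g(2) g2(3,1,2)] prod_unit[OF g(3) g3(3,1,2)]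
  define D where "D = range d1 \<union> range d2 \<union> range d3"
  have D0: "d \<noteq> 0" if "d \<in> D" for d using that pu unfolding D_def by auto
  have "D \<subseteq> R"
  proof (rule ccontr)
    assume notR: "\<not> D \<subseteq> R"
    \<comment> \<open>Measuring by the element of largest absolute valuation makes all entries of the
      diagonal matrices commensurable with it and gives one of them the real valuation 1 or -1.\<close>
    define Y where "Y = D \<union> inverse ` D"
    have "finite Y" "Y \<noteq> {}" "0 \<notin> Y" using D0 unfolding Y_def D_def by auto
    then obtain p where p: "p \<in> Y" "\<And>y. y \<in> Y \<Longrightarrow> y / p \<in> R" using least_valuation by metis
    have p0: "p \<noteq> 0" using p \<open>0 \<notin> Y\<close> by auto
    have pR: "p \<notin> R"
    proof
      assume "p \<in> R"
      then have "y \<in> R" if "y \<in> Y" for y using R_mult[OF p(2)[OF that], of p] p0 by simp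
      then show False using notR unfolding Y_def by blast
    qed
    define x where "x = inverse p"
    have x: "x \<in> R" "\<phi> x = 0" "x \<noteq> 0" using inverse_R[OF pR] \<phi>_inverse[OF pR] p0 by (auto simp: x_def)
    obtain \<nu> :: "'l \<Rightarrow> real" where \<nu>: "\<nu> x = 1"
      "\<And>y z. y \<in> commensurable x \<Longrightarrow> z \<in> commensurable x \<Longrightarrow> \<nu> (y * z) = \<nu> y + \<nu> z"
      "\<And>y. y \<in> commensurable x \<Longrightarrow> y \<in> R \<Longrightarrow> \<nu> y \<ge> 0"
      by (rule real_valuation[OF x], rule that)
    have comm: "d \<in> commensurable x" if "d \<in> D" for d
      using p(2)[of d] p(2)[of "inverse d"] that D0[OF that]
      unfolding commensurable_def Y_def x_def by (auto simp: divide_inverse intro!: exI[of _ 1])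
    have cd: "d1 i \<in> commensurable x" "d2 i \<in> commensurable x" "d3 i \<in> commensurable x" for i
      by (auto intro: comm simp: D_def)
    have \<nu>1: "\<nu> 1 = 0" using \<nu>(2)[OF commensurable_1 commensurable_1] by simp
    have \<nu>_inverse: "\<nu> (inverse y) = - \<nu> y" if "y \<in> commensurable x" for y
      using \<nu>(2)[OF that commensurable_inverse[OF that]] \<nu>1 that by (auto simp: commensurable_def)
    have \<nu>_prod: "\<nu> (\<Prod>i\<in>I. d i) = (\<Sum>i\<in>I. \<nu> (d i))" if "\<And>i. d i \<in> commensurable x" for d :: "'m \<Rightarrow> 'l" and I
      using that by (induction I rule: infinite_finite_induct) (auto simp: \<nu>1 \<nu>(2) commensurable_prod)
    have sum0: "(\<Sum>i\<in>UNIV. \<nu> (d i)) = 0"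
      if d: "\<And>i. d i \<in> commensurable x" "(\<Prod>i\<in>UNIV. d i) \<in> R \<and> inverse (\<Prod>i\<in>UNIV. d i) \<in> R \<and> Q"
      for d :: "'m \<Rightarrow> 'l" and Q
    proof -
      have c: "(\<Prod>i\<in>UNIV. d i) \<in> commensurable x" using d(1) by (rule commensurable_prod)
      have "\<nu> (\<Prod>i\<in>UNIV. d i) \<ge> 0" "\<nu> (inverse (\<Prod>i\<in>UNIV. d i)) \<ge> 0"
        using d(2) c commensurable_inverse \<nu>(3) by blast+
      then show ?thesis using \<nu>_inverse[OF c] \<nu>_prod[OF d(1)] by simp
    qed
    define a where "a i = \<nu> (d1 i)" for i
    define b where "b i = \<nu> (d2 i)" for i
    define c where "c i = \<nu> (d3 i)" for i
    have "\<exists>d\<in>D. \<nu> d \<noteq> 0"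
    proof (cases "p \<in> D")
      case True
      then have "\<nu> p = - 1" using \<nu>_inverse[OF comm[OF True]] \<nu>(1) by (simp add: x_def)
      then show ?thesis using True by (metis neg_equal_zero one_neq_zero zero_neq_one add.inverse_neutral add.inverse_inverse)
    next
      case False
      then obtain d where "d \<in> D" "p = inverse d" using p(1) unfolding Y_def by auto
      then have "\<nu> d = 1" using \<nu>(1) by (simp add: x_def)
      then show ?thesis using \<open>d \<in> D\<close> by (metis zero_neq_one)
    qed
    then have "one_parameter_weights a b c"
      unfolding one_parameter_weights_def a_def b_def c_def
      using sum0[OF cd(1) pu(1)] sum0[OF cd(2) pu(2)] sum0[OF cd(3) pu(3)] unfolding D_def by blast
    moreover have "movable_into (nonneg_support a b c) w"
      unfolding movable_into_def
    proof (intro exI conjI allI impI)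
      show "invertible (map_mat \<phi> k1')" "invertible (map_mat \<phi> k2')" "invertible (map_mat \<phi> k3')"
        using GLR_reduction g1 g2 g3 by auto
      fix i j k assume nz: "act (map_mat \<phi> k1') (map_mat \<phi> k2') (map_mat \<phi> k3') w $ i $ j $ k \<noteq> 0"
      define e where "e = d1 i * d2 j * d3 k"
      have e: "e \<in> commensurable x" "\<nu> e = a i + b j + c k"
        unfolding e_def a_def b_def c_def by (simp_all add: cd commensurable_mult \<nu>(2))
      have e0: "e \<noteq> 0" using e(1) by (simp add: commensurable_def)
      have "e \<in> R"
      proof (rule ccontr)
        assume "e \<notin> R"
        then have "\<phi> (inverse e * (e * y $ i $ j $ k)) = 0"
          using \<phi>_mult[OF inverse_R dy[of i j k, folded e_def]] \<phi>_inverse by simp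
        moreover have "inverse e * (e * y $ i $ j $ k) = y $ i $ j $ k" using e0 by simp
        ultimately show False using nz by (metis \<phi>y map_entry(2))
      qed
      then show "(i, j, k) \<in> nonneg_support a b c"
        using \<nu>(3)[OF e(1)] e(2) by (simp add: nonneg_support_def)
    qed
    ultimately show False using st unfolding stable_def by blast
  qed
  then have "entries_in R (diagonal d1)" "entries_in R (diagonal d2)" "entries_in R (diagonal d3)"
    unfolding D_def by (auto simp: entries_in_def diagonal_def R_0)
  then show ?thesis unfolding g1(3) g2(3) g3(3)
    using g1 g2 g3 by (auto intro!: entries_in_R_mult simp: GLR_def)
qed

end

text \<open>A generic element of \<open>SL\<^sub>m\<close> is obtained from a matrix of independent variables by dividing one
  row by the determinant. Let \<open>v\<close> lie in the Zariski closure of the orbit. At a place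
  specialising the generic point of the orbit to \<open>v\<close>, the previous lemma makes the generic group
  element integral, and its reduction maps \<open>w\<close> to \<open>v\<close>.\<close>

theorem stable_imp_polystable:
  fixes w :: "'m::finite tensor3"
  assumes st: "stable w"
  shows "polystable w"
  unfolding polystable_def
proof (rule zariski_closedI)
  fix v :: "'m tensor3"
  assume v: "\<And>P. polynomial_fun P \<Longrightarrow> (\<And>u. u \<in> SL_orbit w \<Longrightarrow> P u = 0) \<Longrightarrow> P v = 0"
  define X :: "nat \<Rightarrow> (nat \<times> 'm \<times> 'm) polyfun ^ 'm ^ 'm" where "X s = (\<chi> i j. Var (s, i, j))" for s
  define r :: 'm where "r = undefined"
  define \<delta> where "\<delta> s = det (X s)" for s
  \<comment> \<open>The generic group element is \<open>T s / \<delta> s\<close>: clearing its denominator multiplies all rows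
    but row \<open>r\<close> by the determinant.\<close>
  define t where "t s i = (if i = r then 1 else \<delta> s)" for s i
  define T where "T s = (\<chi> i j. t s i * X s $ i $ j)" for s
  define D where "D = \<delta> 0 * \<delta> 1 * \<delta> 2"
  define U where "U i j k = act (T 0) (T 1) (T 2) (map_ten Const w) $ i $ j $ k" for i j k
  have unimod: "det (\<chi> i j. (if i = r then inverse (det M) else 1) * M $ i $ j) = 1"
    if "det M \<noteq> 0" for M :: "'b::field ^ 'm ^ 'm"
  proof -
    have "(\<chi> i j. (if i = r then inverse (det M) else 1) * M $ i $ j)
        = diagonal (\<lambda>i. if i = r then inverse (det M) else 1) ** M"
      by (simp add: vec_eq_iff diagonal_mult)
    moreover have "det (diagonal (\<lambda>i::'m. if i = r then inverse (det M) else 1)) = inverse (det M)"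
      by (subst det_diagonal) (auto simp: diagonal_def)
    ultimately show ?thesis using that by (simp add: det_mul)
  qed
  have \<delta>_ne: "\<delta> s \<noteq> 0" for s
  proof -
    have "map_mat (\<lambda>f. evaluate f (\<lambda>(s, i, j). if i = j then 1 else 0)) (X s) = mat 1"
      by (simp add: vec_eq_iff X_def mat_def)
    then have "evaluate (\<delta> s) (\<lambda>(s, i, j). if i = j then 1 else 0) = 1" by (simp add: \<delta>_def evaluate_det)
    then show ?thesis by auto
  qed
  then have D: "D \<noteq> 0" by (simp add: D_def)
  have "\<exists>R \<phi>. place const_fract R \<phi> \<and> (\<forall>i j k. Fract (U i j k) D \<in> R) \<and> (\<forall>i j k. \<phi> (Fract (U i j k) D) = v $ i $ j $ k)"
  proof (rule place_at_limit[OF D, of U v])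
    fix P :: "'m tensor3 \<Rightarrow> complex"
    assume P: "polynomial_fun P"
      "\<And>x. evaluate D x \<noteq> 0 \<Longrightarrow> P (\<chi> i j k. evaluate (U i j k) x / evaluate D x) = 0"
    show "P v = 0"
    proof (rule v[OF P(1)])
      fix u assume "u \<in> SL_orbit w"
      then obtain g h l where u: "u = act g h l w" "det g = 1" "det h = 1" "det l = 1"
        by (auto simp: SL_orbit_def SL_def tensor_act_eq_act)
      define x where "x = (\<lambda>(s::nat, i, j). (if s = 0 then g else if s = 1 then h else l) $ i $ j)"
      have Xx: "map_mat (\<lambda>f. evaluate f x) (X 0) = g" "map_mat (\<lambda>f. evaluate f x) (X 1) = h"
        "map_mat (\<lambda>f. evaluate f x) (X 2) = l"
        by (simp_all add: vec_eq_iff X_def x_def)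
      then have \<delta>x: "evaluate (\<delta> 0) x = 1" "evaluate (\<delta> 1) x = 1" "evaluate (\<delta> 2) x = 1"
        using u by (simp_all add: \<delta>_def evaluate_det)
      have "map_mat (\<lambda>f. evaluate f x) (T s) = map_mat (\<lambda>f. evaluate f x) (X s)" if "evaluate (\<delta> s) x = 1" for s
        using that by (simp add: vec_eq_iff T_def t_def)
      then have "evaluate (U i j k) x = u $ i $ j $ k" for i j k
        using \<delta>x Xx u(1) by (simp add: U_def evaluate_act map_ten_def)
      moreover have "evaluate D x = 1" using \<delta>x by (simp add: D_def)
      ultimately show "P u = 0" using P(2)[of x] by (simp add: vec_lambda_eta)
    qed
  qed blast
  then obtain R \<phi> where pl: "place const_fract R \<phi>" and UR: "\<And>i j k. Fract (U i j k) D \<in> R"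
    and U\<phi>: "\<And>i j k. \<phi> (Fract (U i j k) D) = v $ i $ j $ k" by blast
  interpret place const_fract R \<phi> by (rule pl)
  define G where "G s = (\<chi> i j. (if i = r then inverse (det (map_mat incl (X s))) else 1) * map_mat incl (X s) $ i $ j)" for s
  have detX: "det (map_mat incl (X s)) = incl (\<delta> s)" for s by (simp add: \<delta>_def incl_det)
  have detG: "det (G s) = 1" for s
    unfolding G_def by (rule unimod) (simp add: detX \<delta>_ne)
  have GT: "G s $ i $ j = incl (T s $ i $ j) / incl (\<delta> s)" for s i j
    by (simp add: G_def T_def t_def detX \<delta>_ne divide_inverse)
  have GU: "act (G 0) (G 1) (G 2) (map_ten const_fract w) $ i $ j $ k = Fract (U i j k) D" for i j k
    unfolding Fract_incl[OF D] by (simp add: act_def GT U_def D_def const_fract_incl sum_divide_distrib)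
  have bounded: "ten_in_R (act (G 0) (G 1) (G 2) (map_ten const_fract w))"
    unfolding ten_in_R_def GU using UR by blast
  have GR: "entries_in R (G 0)" "entries_in R (G 1)" "entries_in R (G 2)"
    using bounded_orbit_point[OF st detG detG detG bounded] by auto
  have "ten_in_R (map_ten const_fract w)" by (simp add: ten_in_R_def emb_R)
  note \<phi>_act[OF GR this]
  moreover have "map_ten \<phi> (act (G 0) (G 1) (G 2) (map_ten const_fract w)) = v"
    by (simp only: vec_eq_iff map_entry GU U\<phi>) simp
  moreover have "map_ten \<phi> (map_ten const_fract w) = w" by (simp add: vec_eq_iff \<phi>_emb)
  ultimately have "v = act (map_mat \<phi> (G 0)) (map_mat \<phi> (G 1)) (map_mat \<phi> (G 2)) w" by simp
  moreover have "det (map_mat \<phi> (G s)) = 1" if "entries_in R (G s)" for s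
    using \<phi>_det[OF that] by (simp add: detG \<phi>_1)
  ultimately show "v \<in> SL_orbit w"
    using GR unfolding SL_orbit_def SL_def tensor_act_eq_act[symmetric] by blast
qed

lemma nonneg_support_parabolic:
  assumes "row_order a p" "row_order b q" "row_order c s"
    and "\<And>i j k. w $ i $ j $ k \<noteq> 0 \<Longrightarrow> (i, j, k) \<in> nonneg_support a b c"
    and "act p q s w $ i $ j $ k \<noteq> 0"
  shows "(i, j, k) \<in> nonneg_support a b c"
proof -
  obtain i' j' k' where *: "p $ i $ i' \<noteq> 0" "q $ j $ j' \<noteq> 0" "s $ k $ k' \<noteq> 0" "w $ i' $ j' $ k' \<noteq> 0"
    using act_nonzero_term[OF assms(5)] .
  then have "a i' \<le> a i" "b j' \<le> b j" "c k' \<le> c k" using assms(1-3) by (auto simp: row_order_def)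
  then show ?thesis using assms(4)[OF *(4)] by (simp add: nonneg_support_def)
qed

text \<open>The set in question is the image of the polynomial map \<open>(h, s) \<mapsto> h s\<close>, where \<open>h\<close> is invertible
  and \<open>s\<close> is supported on nonnegative weights. For a point \<open>v\<close> of its Zariski closure, the
  generic \<open>h\<close> need not be invertible over the valuation ring; but by the Iwasawa form a parabolic
  matrix times the inverse of \<open>h\<close> is, and parabolic matrices preserve the support condition on
  \<open>s\<close>.\<close>

theorem closed_movable_into:
  "zariski_closed {w :: 'm::finite tensor3. movable_into (nonneg_support a b c) w}"
proof (rule zariski_closedI)
  fix v :: "'m tensor3"
  define S where "S = nonneg_support a b c"
  assume v: "\<And>P. polynomial_fun P \<Longrightarrow> (\<And>u. u \<in> {w. movable_into (nonneg_support a b c) w} \<Longrightarrow> P u = 0) \<Longrightarrow> P v = 0"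
  define X :: "nat \<Rightarrow> (nat \<times> 'm \<times> 'm + 'm \<times> 'm \<times> 'm) polyfun ^ 'm ^ 'm"
    where "X s = (\<chi> i j. Var (Inl (s, i, j)))" for s
  define Y :: "(nat \<times> 'm \<times> 'm + 'm \<times> 'm \<times> 'm) polyfun ^ 'm ^ 'm ^ 'm"
    where "Y = (\<chi> i j k. if (i, j, k) \<in> S then Var (Inr (i, j, k)) else 0)"
  \<comment> \<open>Multiplying and dividing by the determinants restricts the parametrisation to invertible
    matrices.\<close>
  define D where "D = det (X 0) * det (X 1) * det (X 2)"
  define U where "U i j k = D * act (X 0) (X 1) (X 2) Y $ i $ j $ k" for i j k
  have X_ne: "det (X s) \<noteq> 0" for s
  proof -
    define x :: "nat \<times> 'm \<times> 'm + 'm \<times> 'm \<times> 'm \<Rightarrow> complex"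
      where "x = case_sum (\<lambda>(s, i, j). if i = j then 1 else 0) (\<lambda>_. 0)"
    have "map_mat (\<lambda>f. evaluate f x) (X s) = mat 1"
      by (simp add: vec_eq_iff X_def mat_def x_def)
    then have "evaluate (det (X s)) x = 1" by (simp add: evaluate_det)
    then show ?thesis by auto
  qed
  then have D: "D \<noteq> 0" by (simp add: D_def)
  have "\<exists>R \<phi>. place const_fract R \<phi> \<and> (\<forall>i j k. Fract (U i j k) D \<in> R) \<and> (\<forall>i j k. \<phi> (Fract (U i j k) D) = v $ i $ j $ k)"
  proof (rule place_at_limit[OF D, of U v])
    fix P :: "'m tensor3 \<Rightarrow> complex"
    assume P: "polynomial_fun P"
      "\<And>x. evaluate D x \<noteq> 0 \<Longrightarrow> P (\<chi> i j k. evaluate (U i j k) x / evaluate D x) = 0"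
    show "P v = 0"
    proof (rule v[OF P(1)])
      fix u assume "u \<in> {w. movable_into (nonneg_support a b c) w}"
      then obtain g h l where u: "invertible g" "invertible h" "invertible l"
        "\<And>i j k. act g h l u $ i $ j $ k \<noteq> 0 \<Longrightarrow> (i, j, k) \<in> S"
        by (auto simp: movable_into_def S_def)
      obtain g' h' l' where u': "g' ** g = mat 1" "h' ** h = mat 1" "l' ** l = mat 1"
        using u(1-3) unfolding invertible_def by auto
      define x where "x = case_sum (\<lambda>(s::nat, i, j). (if s = 0 then g' else if s = 1 then h' else l') $ i $ j)
        (\<lambda>(i, j, k). act g h l u $ i $ j $ k)"
      have Xx: "map_mat (\<lambda>f. evaluate f x) (X 0) = g'" "map_mat (\<lambda>f. evaluate f x) (X 1) = h'"
        "map_mat (\<lambda>f. evaluate f x) (X 2) = l'"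
        by (simp_all add: vec_eq_iff X_def x_def)
      have Yx: "map_ten (\<lambda>f. evaluate f x) Y = act g h l u"
        using u(4) by (auto simp: vec_eq_iff Y_def x_def)
      have "det g' * det g = 1" "det h' * det h = 1" "det l' * det l = 1" using u' by (metis det_I det_mul)+
      then have "det g' \<noteq> 0" "det h' \<noteq> 0" "det l' \<noteq> 0" by auto
      then have Dx: "evaluate D x \<noteq> 0" unfolding D_def evaluate_simps evaluate_det Xx by simp
      moreover have "act g' h' l' (act g h l u) = u" by (simp add: act_act u' act_mat1)
      then have "evaluate (U i j k) x / evaluate D x = u $ i $ j $ k" for i j k
        using Dx unfolding U_def evaluate_simps evaluate_act Xx Yx by simp
      ultimately show "P u = 0" using P(2)[of x] by (simp add: vec_lambda_eta)
    qed
  qed blast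
  then obtain R \<phi> where pl: "place const_fract R \<phi>" and UR: "\<And>i j k. Fract (U i j k) D \<in> R"
    and U\<phi>: "\<And>i j k. \<phi> (Fract (U i j k) D) = v $ i $ j $ k" by blast
  interpret place const_fract R \<phi> by (rule pl)
  define G where "G s = map_mat incl (X s)" for s
  define Z where "Z = map_ten incl Y"
  define W where "W = act (G 0) (G 1) (G 2) Z"
  have W: "W $ i $ j $ k = Fract (U i j k) D" for i j k
    using D by (simp add: W_def U_def G_def Z_def Fract_incl incl_act)
  have "\<exists>G'. invertible G' \<and> G' ** G s = mat 1" for s
  proof -
    have "det (G s) \<noteq> 0" by (simp add: G_def X_ne flip: incl_det)
    then show ?thesis unfolding invertible_det_nz[symmetric] unfolding invertible_def by blast
  qed
  then obtain G' where G': "\<And>s. invertible (G' s)" "\<And>s. G' s ** G s = mat 1" by metis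
  obtain p1 k1 where 1: "row_order a p1" "GLR k1" "p1 ** G' 0 = k1" by (rule iwasawa_form[OF G'(1)])
  obtain p2 k2 where 2: "row_order b p2" "GLR k2" "p2 ** G' 1 = k2" by (rule iwasawa_form[OF G'(1)])
  obtain p3 k3 where 3: "row_order c p3" "GLR k3" "p3 ** G' 2 = k3" by (rule iwasawa_form[OF G'(1)])
  have "k1 ** G 0 = p1" "k2 ** G 1 = p2" "k3 ** G 2 = p3"
    unfolding 1(3)[symmetric] 2(3)[symmetric] 3(3)[symmetric] using G'(2)
    by (simp_all flip: matrix_mul_assoc)
  then have kW: "act k1 k2 k3 W = act p1 p2 p3 Z" by (simp add: W_def act_act)
  have Zsupp: "(i, j, k) \<in> nonneg_support a b c" if "Z $ i $ j $ k \<noteq> 0" for i j k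
    using that by (auto simp: Z_def Y_def S_def split: if_splits)
  have "movable_into (nonneg_support a b c) v"
    unfolding movable_into_def
  proof (intro exI conjI allI impI)
    show "invertible (map_mat \<phi> k1)" "invertible (map_mat \<phi> k2)" "invertible (map_mat \<phi> k3)"
      using GLR_reduction 1 2 3 by auto
    fix i j k assume nz: "act (map_mat \<phi> k1) (map_mat \<phi> k2) (map_mat \<phi> k3) v $ i $ j $ k \<noteq> 0"
    have "map_ten \<phi> W = v" by (simp add: vec_eq_iff W U\<phi>)
    moreover have "ten_in_R W" by (simp add: ten_in_R_def W UR)
    ultimately have "act (map_mat \<phi> k1) (map_mat \<phi> k2) (map_mat \<phi> k3) v = map_ten \<phi> (act k1 k2 k3 W)"
      using \<phi>_act[of k1 k2 k3 W] 1(2) 2(2) 3(2) by (simp add: GLR_def)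
    then have "\<phi> (act p1 p2 p3 Z $ i $ j $ k) \<noteq> 0" using nz by (simp add: kW)
    then have "act p1 p2 p3 Z $ i $ j $ k \<noteq> 0" using \<phi>_0 by metis
    then show "(i, j, k) \<in> nonneg_support a b c"
      using nonneg_support_parabolic[OF 1(1) 2(1) 3(1) Zsupp] by blast
  qed
  then show "v \<in> {w. movable_into (nonneg_support a b c) w}" by simp
qed

text \<open>There are infinitely many weights, but only finitely many supports.\<close>

theorem zariski_open_stable: "zariski_open {w :: 'm::finite tensor3. stable w}"
proof -
  define \<S> where "\<S> = {nonneg_support a b c | a b c :: 'm \<Rightarrow> real. one_parameter_weights a b c}"
  have "- {w :: 'm tensor3. stable w} = (\<Union>S\<in>\<S>. {w. movable_into S w})"
    unfolding \<S>_def stable_def by blast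
  moreover have "zariski_closed (\<Union>S\<in>\<S>. {w :: 'm tensor3. movable_into S w})"
  proof (rule zariski_closed_UN)
    show "finite \<S>" by (rule finite_subset[of _ UNIV]) auto
  qed (auto simp: \<S>_def intro: closed_movable_into)
  ultimately show ?thesis unfolding zariski_open_def by simp
qed

section \<open>A stability criterion of Kempf--Ness type\<close>

definition adj :: "complex ^ 'n ^ 'n \<Rightarrow> complex ^ 'n ^ 'n::finite" where
  "adj A = (\<chi> i j. cnj (A $ j $ i))"

definition herm :: "complex ^ 'n \<Rightarrow> complex ^ 'n::finite \<Rightarrow> complex" where
  "herm x y = (\<Sum>c\<in>UNIV. x $ c * cnj (y $ c))"

lemma mult_adj_nth: "(A ** adj B) $ i $ j = herm (A $ i) (B $ j)"
  by (simp add: matrix_matrix_mult_def adj_def herm_def)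

lemma herm_cnj: "cnj (herm x y) = herm y x"
  by (simp add: herm_def mult.commute)

lemma herm_self: "herm x x = of_real (\<Sum>c\<in>UNIV. (cmod (x $ c))\<^sup>2)"
  by (simp add: herm_def complex_norm_square del: of_real_power)

text \<open>Orthonormalising the rows by increasing weight uses only operations that respect the weights.
  This is the Iwasawa decomposition over \<open>\<complex>\<close>, with the unitary group in place of the matrices
  invertible over a valuation ring.\<close>

lemma gram_schmidt:
  fixes M :: "complex ^ 'n ^ 'n::finite" and a :: "'n \<Rightarrow> real"
  assumes "invertible M"
  obtains q k where "row_order a q" "q ** M = k" "k ** adj k = mat 1"
proof -
  have "\<exists>q. row_order a q \<and> (q ** M) ** adj (q ** M) = mat 1"
    if "invertible M" "\<And>i j. i \<notin> F \<Longrightarrow> j \<in> F \<Longrightarrow> a i \<le> a j"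
      "\<And>i j. i \<notin> F \<Longrightarrow> j \<notin> F \<Longrightarrow> herm (M $ i) (M $ j) = (if i = j then 1 else 0)"
    for F and M :: "complex ^ 'n ^ 'n"
    using finite[of F] that
  proof (induction F arbitrary: M rule: finite_psubset_induct)
    case (psubset F)
    show ?case
    proof (cases "F = {}")
      case True
      then have "M ** adj M = mat 1" using psubset.prems(3) by (simp add: vec_eq_iff mult_adj_nth mat_def)
      moreover have "row_order a (mat 1 :: complex ^ 'n ^ 'n)" by (auto simp: row_order_def mat_def)
      ultimately show ?thesis by (metis matrix_mul_lid)
    next
      case False
      obtain s where s: "s \<in> F" "\<And>i. i \<in> F \<Longrightarrow> a s \<le> a i"
        using ex_min_if_finite[of "a ` F"] False psubset.hyps
        by (metis (no_types, lifting) finite_imageI image_iff image_is_empty linorder_not_le imageI)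
      define v where "v c = (if c \<in> F then 0 else - herm (M $ s) (M $ c))" for c
      define E where "E = transpose (shear v s)"
      define M1 where "M1 = E ** M"
      have M1: "M1 $ r = (if r = s then M $ s + (\<Sum>x\<in>-F. v x *s M $ x) else M $ r)" for r
      proof (rule vec_eq_iff[THEN iffD2], rule allI)
        fix c
        show "M1 $ r $ c = (if r = s then M $ s + (\<Sum>x\<in>-F. v x *s M $ x) else M $ r) $ c"
        proof (cases "r = s")
          case False
          have "M1 $ r $ c = (\<Sum>x\<in>UNIV. if x = r then M $ r $ c else 0)"
            unfolding M1_def E_def matrix_matrix_mult_def vec_lambda_beta
            by (intro sum.cong refl) (use False in \<open>auto simp: transpose_def shear_def\<close>)
          then show ?thesis using False by simp
        next
          case True
          have "M1 $ r $ c = (\<Sum>x\<in>UNIV. (if x = s then M $ s $ c else 0) + (if x \<in> - F then v x * M $ x $ c else 0))"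
            unfolding M1_def E_def matrix_matrix_mult_def vec_lambda_beta
            by (intro sum.cong refl) (use True s(1) in \<open>auto simp: transpose_def shear_def v_def\<close>)
          also have "\<dots> = M $ s $ c + (\<Sum>x\<in>-F. v x * M $ x $ c)"
            by (simp add: sum.distrib flip: sum.inter_restrict[of UNIV "\<lambda>x. v x * M $ x $ c" "- F", simplified])
          finally show ?thesis using True by (simp add: sum_component)
        qed
      qed
      have herm_M1: "herm (M1 $ s) (M $ f) = 0" if "f \<notin> F" for f
      proof -
        have "herm (M1 $ s) (M $ f) = herm (M $ s) (M $ f) + (\<Sum>x\<in>-F. v x * herm (M $ x) (M $ f))"
          by (simp add: M1 herm_def sum_component distrib_right sum.distrib sum_distrib_left sum_distrib_right mult.assoc)
            (rule sum.swap)
        also have "(\<Sum>x\<in>-F. v x * herm (M $ x) (M $ f)) = (\<Sum>x\<in>-F. if x = f then v f else 0)"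
          by (intro sum.cong refl) (use that psubset.prems(3) in auto)
        also have "\<dots> = v f" using that by (simp add: sum.delta)
        finally show ?thesis using that by (simp add: v_def)
      qed
      have "invertible (shear v s)" by (rule invertible_fieldI[OF shear_inverse])
      then have invE: "invertible E" by (simp add: E_def invertible_det_nz det_transpose)
      then have inv1: "invertible M1" unfolding M1_def using invertible_mult psubset.prems(1) by blast
      then obtain c0 where "M1 $ s $ c0 \<noteq> 0" using invertible_row_nonzero by blast
      then have "(\<Sum>c\<in>UNIV. (cmod (M1 $ s $ c))\<^sup>2) > 0"
        by (intro sum_pos2[of _ c0]) auto
      then obtain N where N: "N > 0" "herm (M1 $ s) (M1 $ s) = of_real N" using herm_self by metis
      define d where "d r = (if r = s then complex_of_real (1 / sqrt N) else 1)" for r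
      define M2 where "M2 = diagonal d ** M1"
      have M2: "M2 $ r = d r *s M1 $ r" for r by (simp add: M2_def vec_eq_iff diagonal_mult)
      have herm_M2: "herm (M2 $ i) (M2 $ j) = d i * cnj (d j) * herm (M1 $ i) (M1 $ j)" for i j
        by (simp add: M2 herm_def sum_distrib_left mult_ac)
      have invd: "invertible (diagonal d)"
        by (rule invertible_fieldI[OF diagonal_inverse]) (use N in \<open>auto simp: d_def\<close>)
      then have inv2: "invertible M2" unfolding M2_def using invertible_mult inv1 by blast
      have orth: "herm (M2 $ i) (M2 $ j) = (if i = j then 1 else 0)" if "i \<notin> F - {s}" "j \<notin> F - {s}" for i j
      proof -
        have ss: "herm (M2 $ s) (M2 $ s) = 1"
          using N by (simp add: herm_M2 d_def flip: of_real_mult)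
        have sj: "herm (M2 $ s) (M2 $ f) = 0" if "f \<notin> F" for f
          using herm_M1[OF that] that s(1) by (auto simp: herm_M2 M1)
        have js: "herm (M2 $ f) (M2 $ s) = 0" if "f \<notin> F" for f
          using sj[OF that] by (metis herm_cnj complex_cnj_zero)
        have ff: "herm (M2 $ i) (M2 $ j) = (if i = j then 1 else 0)" if "i \<notin> F" "j \<notin> F"
        proof -
          have "i \<noteq> s" "j \<noteq> s" using that s(1) by auto
          then show ?thesis using psubset.prems(3)[OF that] by (simp add: herm_M2 M1 d_def)
        qed
        show ?thesis
        proof (cases "i = s")
          case True
          then show ?thesis using ss sj[of j] that by (cases "j = s") auto
        next
          case False
          then show ?thesis using ff js[of i] that by (cases "j = s") auto
        qed
      qed
      have low: "a i \<le> a j" if "i \<notin> F - {s}" "j \<in> F - {s}" for i j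
        using that psubset.prems(2) s by blast
      have "F - {s} \<subset> F" using s by auto
      then obtain q where q: "row_order a q" "(q ** M2) ** adj (q ** M2) = mat 1"
        using psubset.IH[OF _ inv2 low orth] by blast
      have "row_order a E" unfolding E_def row_order_def
        using psubset.prems(2) s by (auto simp: transpose_def shear_def v_def)
      then have "row_order a (q ** (diagonal d ** E))" by (intro row_order_mult q row_order_diagonal)
      moreover have "q ** M2 = q ** (diagonal d ** E) ** M" by (simp add: M2_def M1_def matrix_mul_assoc)
      ultimately show ?thesis using q(2) by metis
    qed
  qed
  from this[of M UNIV] show ?thesis using assms that by auto
qed

text \<open>The Gram matrix of the slices in the first direction. It is the reduced density matrix of the
  tensor and, up to a multiple of the identity, its component of the moment map.\<close>

definition slice_gram :: "'m::finite tensor3 \<Rightarrow> 'm \<Rightarrow> 'm \<Rightarrow> complex" where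
  "slice_gram w i i' = (\<Sum>j\<in>UNIV. \<Sum>k\<in>UNIV. w $ i $ j $ k * cnj (w $ i' $ j $ k))"

lemma unitary_herm:
  assumes "U ** adj U = mat 1"
  shows "(\<Sum>j\<in>UNIV. (\<Sum>b\<in>UNIV. U $ j $ b * x b) * cnj (\<Sum>b\<in>UNIV. U $ j $ b * y b)) = (\<Sum>b\<in>UNIV. x b * cnj (y b))"
proof -
  have "adj U ** U = mat 1" using assms matrix_left_right_inverse by blast
  then have col: "(\<Sum>j\<in>UNIV. cnj (U $ j $ b') * U $ j $ b) = (if b' = b then 1 else 0)" for b b'
    by (simp add: vec_eq_iff matrix_matrix_mult_def adj_def mat_def)
  have "(\<Sum>j\<in>UNIV. (\<Sum>b\<in>UNIV. U $ j $ b * x b) * cnj (\<Sum>b\<in>UNIV. U $ j $ b * y b))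
      = (\<Sum>j\<in>UNIV. \<Sum>b\<in>UNIV. \<Sum>b'\<in>UNIV. x b * cnj (y b') * (cnj (U $ j $ b') * U $ j $ b))"
    by (simp add: sum_product mult_ac)
  also have "\<dots> = (\<Sum>b\<in>UNIV. \<Sum>b'\<in>UNIV. \<Sum>j\<in>UNIV. x b * cnj (y b') * (cnj (U $ j $ b') * U $ j $ b))"
    by (subst sum.swap) (intro sum.cong refl sum.swap)
  also have "\<dots> = (\<Sum>b\<in>UNIV. x b * cnj (y b))"
    by (simp add: col mult_delta_right flip: sum_distrib_left)
  finally show ?thesis .
qed

lemma slice_gram_mode2: "U ** adj U = mat 1 \<Longrightarrow> slice_gram (mode2 U w) i i' = slice_gram w i i'"
  unfolding slice_gram_def mode2_def vec_lambda_beta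
  by (subst (1 2) sum.swap) (simp only: unitary_herm)

lemma slice_gram_mode3: "U ** adj U = mat 1 \<Longrightarrow> slice_gram (mode3 U w) i i' = slice_gram w i i'"
  unfolding slice_gram_def mode3_def vec_lambda_beta
  by (simp only: unitary_herm)

lemma slice_gram_mode1:
  "slice_gram (mode1 U w) i i' = (\<Sum>a\<in>UNIV. \<Sum>a'\<in>UNIV. U $ i $ a * cnj (U $ i' $ a') * slice_gram w a a')"
proof -
  have "slice_gram (mode1 U w) i i' = (\<Sum>j\<in>UNIV. \<Sum>k\<in>UNIV. \<Sum>a\<in>UNIV. \<Sum>a'\<in>UNIV.
      U $ i $ a * cnj (U $ i' $ a') * (w $ a $ j $ k * cnj (w $ a' $ j $ k)))"
    by (simp add: slice_gram_def mode1_def sum_product mult_ac)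
  also have "\<dots> = (\<Sum>j\<in>UNIV. \<Sum>a\<in>UNIV. \<Sum>a'\<in>UNIV. \<Sum>k\<in>UNIV.
      U $ i $ a * cnj (U $ i' $ a') * (w $ a $ j $ k * cnj (w $ a' $ j $ k)))"
    by (rule sum.cong[OF refl], subst sum.swap, rule sum.cong[OF refl], rule sum.swap)
  also have "\<dots> = (\<Sum>a\<in>UNIV. \<Sum>a'\<in>UNIV. \<Sum>j\<in>UNIV. \<Sum>k\<in>UNIV.
      U $ i $ a * cnj (U $ i' $ a') * (w $ a $ j $ k * cnj (w $ a' $ j $ k)))"
    by (subst sum.swap, rule sum.cong[OF refl], rule sum.swap)
  finally show ?thesis by (simp add: slice_gram_def sum_distrib_left)
qed

lemma slice_norm_unitary:
  assumes "U ** adj U = mat 1" "V ** adj V = mat 1" "W ** adj W = mat 1"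
    and "\<And>i i'. slice_gram w i i' = (if i = i' then 1 else 0)"
  shows "(\<Sum>j\<in>UNIV. \<Sum>k\<in>UNIV. (cmod (act U V W w $ i $ j $ k))\<^sup>2) = 1"
proof -
  have "slice_gram (act U V W w) i i = (\<Sum>a\<in>UNIV. U $ i $ a * cnj (U $ i $ a))"
    by (simp add: act_modes slice_gram_mode1 slice_gram_mode2[OF assms(2)] slice_gram_mode3[OF assms(3)]
        assms(4) mult_delta_right)
  also have "\<dots> = 1" using assms(1) by (simp add: vec_eq_iff mult_adj_nth mat_def herm_def)
  finally have "complex_of_real (\<Sum>j\<in>UNIV. \<Sum>k\<in>UNIV. (cmod (act U V W w $ i $ j $ k))\<^sup>2) = 1"
    by (simp add: slice_gram_def complex_norm_square del: of_real_power)
  then show ?thesis by (simp only: of_real_eq_1_iff)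
qed

text \<open>A cyclic symmetry of the tensor carries statements about the first factor to the other two.\<close>

lemma act_rotate:
  assumes "\<And>i j k. w $ j $ k $ i = w $ i $ j $ k"
  shows "act A B C w $ k $ i $ j = act B C A w $ i $ j $ k"
proof -
  have "act A B C w $ k $ i $ j = (\<Sum>b\<in>UNIV. \<Sum>c\<in>UNIV. \<Sum>a\<in>UNIV. A $ k $ a * B $ i $ b * C $ j $ c * w $ a $ b $ c)"
    unfolding act_def vec_lambda_beta by (subst sum.swap) (intro sum.cong refl sum.swap)
  also have "\<dots> = act B C A w $ i $ j $ k"
    unfolding act_def vec_lambda_beta by (intro sum.cong refl) (simp add: mult_ac assms)
  finally show ?thesis .
qed

lemma mode_mat1: "mode1 (mat 1) w = w" "mode2 (mat 1) w = w" "mode3 (mat 1) w = w"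
  by (simp_all add: mode1_def mode2_def mode3_def mat_def vec_eq_iff if_distrib[of "\<lambda>x. x * _"] cong: if_cong)

lemma act_add: "act A B C (v + w) = act A B C v + act A B C w"
  by (simp add: act_def vec_eq_iff distrib_left sum.distrib)

lemma act_0: "act A B C 0 = 0"
  by (simp add: act_def vec_eq_iff)

lemma trace_conj:
  assumes "U ** adj U = mat 1"
  shows "trace (adj U ** D ** U) = trace D"
proof -
  have "trace (adj U ** D ** U) = trace (U ** (adj U ** D))" by (rule trace_mul_sym)
  then show ?thesis using assms by (simp add: matrix_mul_assoc)
qed

text \<open>The assumption \<open>gram\<close> says that \<open>w\<close> is a zero of the moment map, and \<open>kernel\<close> that its
  stabiliser in \<open>SL\<^sub>m\<^sup>3\<close> is finite. If weights destabilise \<open>w\<close>, they do so after a unitary base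
  change, by \<open>gram_schmidt\<close>. Unitary base changes preserve the Gram matrices, so for the resulting
  tensor \<open>u\<close> the total of the weights with respect to \<open>\<bar>u\<bar>\<^sup>2\<close> is the sum of all weights, that is,
  zero. As only nonnegative weights occur in \<open>u\<close>, only weight zero occurs. Then the diagonal
  matrices of the weights annihilate \<open>u\<close>, and their conjugates annihilate \<open>w\<close>. The cyclic symmetry
  serves to state the condition on Gram matrices for one direction only.\<close>

theorem kempf_ness_stable:
  fixes w :: "'m::finite tensor3"
  assumes sym: "\<And>i j k. w $ j $ k $ i = w $ i $ j $ k"
    and gram: "\<And>i i'. slice_gram w i i' = (if i = i' then 1 else 0)"
    and kernel: "\<And>X Y Z. trace X = 0 \<Longrightarrow> trace Y = 0 \<Longrightarrow> trace Z = 0 \<Longrightarrow>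
      mode1 X w + mode2 Y w + mode3 Z w = 0 \<Longrightarrow> X = 0 \<and> Y = 0 \<and> Z = 0"
  shows "stable w"
  unfolding stable_def
proof (intro allI impI notI)
  fix a b c
  assume abc: "one_parameter_weights a b c" and "movable_into (nonneg_support a b c) w"
  then obtain g h l where ghl: "invertible g" "invertible h" "invertible l"
    "\<And>i j k. act g h l w $ i $ j $ k \<noteq> 0 \<Longrightarrow> (i, j, k) \<in> nonneg_support a b c"
    unfolding movable_into_def by auto
  obtain p U where 1: "row_order a p" "p ** g = U" "U ** adj U = mat 1" by (rule gram_schmidt[OF ghl(1)])
  obtain q V where 2: "row_order b q" "q ** h = V" "V ** adj V = mat 1" by (rule gram_schmidt[OF ghl(2)])
  obtain s W where 3: "row_order c s" "s ** l = W" "W ** adj W = mat 1" by (rule gram_schmidt[OF ghl(3)])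
  define u where "u = act U V W w"
  have "u = act p q s (act g h l w)" by (simp add: u_def act_act 1 2 3)
  then have supp: "0 \<le> a i + b j + c k" if "u $ i $ j $ k \<noteq> 0" for i j k
    using nonneg_support_parabolic[OF 1(1) 2(1) 3(1) ghl(4)] that by (fastforce simp: nonneg_support_def)
  define n where "n i j k = (cmod (u $ i $ j $ k))\<^sup>2" for i j k
  have n1: "(\<Sum>j\<in>UNIV. \<Sum>k\<in>UNIV. n i j k) = 1" for i
    using slice_norm_unitary[OF 1(3) 2(3) 3(3) gram] by (simp add: n_def u_def)
  have rot: "u $ k $ i $ j = act V W U w $ i $ j $ k" for i j k
    unfolding u_def by (rule act_rotate) (rule sym)
  have rot2: "u $ j $ k $ i = act W U V w $ i $ j $ k" for i j k
    unfolding rot by (rule act_rotate) (rule sym)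
  have n3: "(\<Sum>j\<in>UNIV. \<Sum>k\<in>UNIV. n j k i) = 1" for i
    using slice_norm_unitary[OF 3(3) 1(3) 2(3) gram] by (simp add: n_def rot2)
  have n2: "(\<Sum>j\<in>UNIV. \<Sum>k\<in>UNIV. n k i j) = 1" for i
    using slice_norm_unitary[OF 2(3) 3(3) 1(3) gram] by (simp add: n_def rot)
  have "(\<Sum>i\<in>UNIV. \<Sum>j\<in>UNIV. \<Sum>k\<in>UNIV. (a i + b j + c k) * n i j k)
      = (\<Sum>i\<in>UNIV. \<Sum>j\<in>UNIV. \<Sum>k\<in>UNIV. a i * n i j k) + (\<Sum>i\<in>UNIV. \<Sum>j\<in>UNIV. \<Sum>k\<in>UNIV. b j * n i j k)
        + (\<Sum>i\<in>UNIV. \<Sum>j\<in>UNIV. \<Sum>k\<in>UNIV. c k * n i j k)"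
    by (simp add: distrib_right sum.distrib)
  also have "(\<Sum>i\<in>UNIV. \<Sum>j\<in>UNIV. \<Sum>k\<in>UNIV. a i * n i j k) = (\<Sum>i\<in>UNIV. a i * (\<Sum>j\<in>UNIV. \<Sum>k\<in>UNIV. n i j k))"
    by (simp add: sum_distrib_left)
  also have "\<dots> = 0" using abc by (simp add: n1 one_parameter_weights_def)
  also have "(\<Sum>i\<in>UNIV. \<Sum>j\<in>UNIV. \<Sum>k\<in>UNIV. b j * n i j k) = (\<Sum>j\<in>UNIV. \<Sum>k\<in>UNIV. \<Sum>i\<in>UNIV. b j * n i j k)"
    by (subst sum.swap, rule sum.cong[OF refl], rule sum.swap)
  also have "\<dots> = (\<Sum>j\<in>UNIV. b j * (\<Sum>k\<in>UNIV. \<Sum>i\<in>UNIV. n i j k))"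
    by (simp add: sum_distrib_left)
  also have "\<dots> = 0" using abc by (simp add: n2 one_parameter_weights_def)
  also have "(\<Sum>i\<in>UNIV. \<Sum>j\<in>UNIV. \<Sum>k\<in>UNIV. c k * n i j k) = (\<Sum>k\<in>UNIV. \<Sum>i\<in>UNIV. \<Sum>j\<in>UNIV. c k * n i j k)"
  proof -
    have "(\<Sum>i\<in>UNIV. \<Sum>j\<in>UNIV. \<Sum>k\<in>UNIV. c k * n i j k) = (\<Sum>i\<in>UNIV. \<Sum>k\<in>UNIV. \<Sum>j\<in>UNIV. c k * n i j k)"
      by (rule sum.cong[OF refl], rule sum.swap)
    also have "\<dots> = (\<Sum>k\<in>UNIV. \<Sum>i\<in>UNIV. \<Sum>j\<in>UNIV. c k * n i j k)" by (rule sum.swap)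
    finally show ?thesis .
  qed
  also have "\<dots> = (\<Sum>k\<in>UNIV. c k * (\<Sum>i\<in>UNIV. \<Sum>j\<in>UNIV. n i j k))"
    by (simp add: sum_distrib_left)
  also have "\<dots> = 0" using abc by (simp add: n3 one_parameter_weights_def)
  finally have total: "(\<Sum>i\<in>UNIV. \<Sum>j\<in>UNIV. \<Sum>k\<in>UNIV. (a i + b j + c k) * n i j k) = 0" by simp
  have nonneg: "0 \<le> (a i + b j + c k) * n i j k" for i j k
    using supp[of i j k] by (cases "u $ i $ j $ k = 0") (auto simp: n_def)
  have zero: "(a i + b j + c k) * n i j k = 0" for i j k
    using total nonneg by (simp add: sum_nonneg_eq_0_iff sum_nonneg)
  define A where "A = diagonal (\<lambda>i. complex_of_real (a i))"
  define B where "B = diagonal (\<lambda>i. complex_of_real (b i))"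
  define C where "C = diagonal (\<lambda>i. complex_of_real (c i))"
  have mode_diag: "mode1 A u $ i $ j $ k = a i * u $ i $ j $ k" "mode2 B u $ i $ j $ k = b j * u $ i $ j $ k"
    "mode3 C u $ i $ j $ k = c k * u $ i $ j $ k" for i j k
    by (simp_all add: A_def B_def C_def mode1_def mode2_def mode3_def diagonal_def if_distrib[of "\<lambda>x. x * _"] cong: if_cong)
  have "mode1 A u + mode2 B u + mode3 C u = 0"
  proof -
    have "complex_of_real (a i) * u $ i $ j $ k + b j * u $ i $ j $ k + c k * u $ i $ j $ k = 0" for i j k
    proof -
      have "a i + b j + c k = 0 \<or> u $ i $ j $ k = 0" using zero[of i j k] by (auto simp: n_def)
      moreover have "complex_of_real (a i) * u $ i $ j $ k + b j * u $ i $ j $ k + c k * u $ i $ j $ k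
          = complex_of_real (a i + b j + c k) * u $ i $ j $ k" by (simp add: algebra_simps)
      ultimately show ?thesis by (metis mult_zero_left mult_zero_right of_real_0)
    qed
    then show ?thesis by (simp add: vec_eq_iff mode_diag)
  qed
  then have "act (adj U) (adj V) (adj W) (mode1 A u) + act (adj U) (adj V) (adj W) (mode2 B u)
      + act (adj U) (adj V) (adj W) (mode3 C u) = 0"
    by (metis act_add act_0)
  moreover have adj: "adj U ** U = mat 1" "adj V ** V = mat 1" "adj W ** W = mat 1"
    using 1 2 3 matrix_left_right_inverse by blast+
  have "act (adj U) (adj V) (adj W) (mode1 A u) = mode1 (adj U ** A ** U) w"
    "act (adj U) (adj V) (adj W) (mode2 B u) = mode2 (adj V ** B ** V) w"
    "act (adj U) (adj V) (adj W) (mode3 C u) = mode3 (adj W ** C ** W) w"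
    unfolding u_def act_modes
    by (simp_all only: mode3_mode1 mode3_mode2 mode2_mode1 mode1_mode1 mode2_mode2 mode3_mode3 adj mode_mat1 matrix_mul_assoc)
  moreover have "trace (adj U ** A ** U) = 0" "trace (adj V ** B ** V) = 0" "trace (adj W ** C ** W) = 0"
    unfolding trace_conj[OF 1(3)] trace_conj[OF 2(3)] trace_conj[OF 3(3)] A_def B_def C_def
    using abc by (simp_all add: trace_def diagonal_def one_parameter_weights_def flip: of_real_sum)
  ultimately have "adj U ** A ** U = 0 \<and> adj V ** B ** V = 0 \<and> adj W ** C ** W = 0"
    using kernel by metis
  moreover have "D = 0" if "adj T ** D ** T = 0" "T ** adj T = mat 1" for D T :: "complex ^ 'm ^ 'm"
  proof -
    have "(T ** adj T) ** D ** (T ** adj T) = T ** (adj T ** D ** T) ** adj T" by (simp only: matrix_mul_assoc)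
    then show ?thesis using that by simp
  qed
  ultimately have "A = 0" "B = 0" "C = 0" using 1(3) 2(3) 3(3) by blast+
  then have "complex_of_real (a i) = 0" "complex_of_real (b i) = 0" "complex_of_real (c i) = 0" for i
  proof -
    have "complex_of_real (a i) = A $ i $ i" "complex_of_real (b i) = B $ i $ i"
      "complex_of_real (c i) = C $ i $ i" by (simp_all add: A_def B_def C_def diagonal_def)
    then show "complex_of_real (a i) = 0" "complex_of_real (b i) = 0" "complex_of_real (c i) = 0"
      using \<open>A = 0\<close> \<open>B = 0\<close> \<open>C = 0\<close> by simp_all
  qed
  then show False using abc by (auto simp: one_parameter_weights_def)
qed

section \<open>A stable tensor when \<open>m \<ge> 3\<close>\<close>

lemma const_diff_zero_sums:
  fixes f g :: "'m::finite \<Rightarrow> complex"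
  assumes "\<And>i j. i \<noteq> j \<Longrightarrow> f i - g i = f j - g j" "sum f UNIV = 0" "sum g UNIV = 0"
  shows "f i = g i"
proof -
  have "0 = (\<Sum>j\<in>UNIV. f j - g j)" using assms by (simp add: sum_subtractf)
  also have "\<dots> = (\<Sum>j\<in>(UNIV :: 'm set). f i - g i)" by (intro sum.cong refl) (metis assms(1))
  also have "\<dots> = of_nat CARD('m) * (f i - g i)" by simp
  finally show ?thesis by simp
qed

text \<open>The two quantities by which one has to divide when solving for the stabiliser below.\<close>

lemma nat_quadratics:
  fixes n :: nat
  assumes "n \<ge> 3"
  shows "(of_nat n :: complex)\<^sup>2 \<noteq> 6 * (of_nat n - 1)" "(of_nat n :: complex)\<^sup>2 \<noteq> 2 * (of_nat n - 2)"
proof -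
  have "n\<^sup>2 + 6 \<noteq> 6 * n"
  proof (cases "n < 6")
    case True
    then have "n = 3 \<or> n = 4 \<or> n = 5" using assms by arith
    then show ?thesis by auto
  next
    case False
    then have "6 * n \<le> n * n" by (intro mult_right_mono) auto
    then show ?thesis unfolding power2_eq_square by linarith
  qed
  then have "(of_nat (n\<^sup>2 + 6) :: complex) \<noteq> of_nat (6 * n)" by (subst of_nat_eq_iff)
  then show "(of_nat n :: complex)\<^sup>2 \<noteq> 6 * (of_nat n - 1)" by (auto simp: algebra_simps)
  have "3 * n \<le> n * n" using assms by (intro mult_right_mono) auto
  then have "n\<^sup>2 + 4 \<noteq> 2 * n" unfolding power2_eq_square by linarith
  then have "(of_nat (n\<^sup>2 + 4) :: complex) \<noteq> of_nat (2 * n)" by (subst of_nat_eq_iff)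
  then show "(of_nat n :: complex)\<^sup>2 \<noteq> 2 * (of_nat n - 2)" by (auto simp: algebra_simps)
qed

text \<open>The coefficient \<open>2/m\<^sup>2\<close> is the nonzero real number for which subtracting that multiple of the
  all-ones tensor from the unit tensor leaves the slices orthonormal. The perturbation is needed because the unit
  tensor is stabilised by a torus.\<close>

definition perturbed_unit :: "'m::finite tensor3" where
  "perturbed_unit = (\<chi> i j k. (if i = j \<and> j = k then 1 else 0) - 2 / (of_nat CARD('m))\<^sup>2)"

text \<open>The hypothesis \<open>eq\<close> is the entry \<open>(i, j, k)\<close> of the equation saying that the triple \<open>(X, Y, Z)\<close>
  annihilates the tensor; \<open>r, s, t\<close> are the row sums of the three matrices. Since there are at least
  three indices, the entries with distinct \<open>i, j, k\<close> show that \<open>r - s\<close> and \<open>r - t\<close> are constant.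
  The entries with two equal indices express the off-diagonal elements of the matrices by the row
  sums. Summing them up, with the traces zero, gives \<open>(m\<^sup>2 - 6 (m - 1)) \<Sum> r = 0\<close>, so that all
  total sums vanish; and with the entries with \<open>i = j = k\<close> it gives
  \<open>(m\<^sup>2 - 2 (m - 2)) (r\<^sub>i + s\<^sub>i + t\<^sub>i) = 0\<close>. Both integer factors are nonzero, and
  \<open>r = s = t = 0\<close> follows.\<close>

lemma perturbed_unit_stabilizer_component:
  fixes X Y Z :: "complex ^ 'm ^ 'm::finite"
  defines "r \<equiv> (\<lambda>i. \<Sum>j\<in>UNIV. X $ i $ j)" and "s \<equiv> (\<lambda>i. \<Sum>j\<in>UNIV. Y $ i $ j)" and "t \<equiv> (\<lambda>i. \<Sum>j\<in>UNIV. Z $ i $ j)"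
  defines "c \<equiv> 2 / (of_nat CARD('m))\<^sup>2"
  assumes card: "CARD('m) \<ge> 3"
    and tr: "trace X = 0" "trace Y = 0" "trace Z = 0"
    and eq: "\<And>i j k. (if j = k then X $ i $ j else 0) + (if i = k then Y $ j $ i else 0) + (if i = j then Z $ k $ i else 0)
      = c * (r i + s j + t k)"
  shows "X = 0"
proof -
  define n where "n = (of_nat CARD('m) :: complex)"
  have n0: "n \<noteq> 0" by (simp add: n_def)
  have third: "\<exists>k. k \<noteq> i \<and> k \<noteq> j" for i j :: 'm
  proof (rule ccontr)
    assume "\<not> ?thesis"
    then have "(UNIV :: 'm set) \<subseteq> {i, j}" by auto
    then have "CARD('m) \<le> card {i, j}" by (rule card_mono[rotated]) simp
    also have "\<dots> \<le> 2" by (simp add: card_insert_if)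
    finally show False using card by simp
  qed
  have c0: "c \<noteq> 0" using n0 by (simp add: c_def n_def)
  have dist: "r i + s j + t k = 0" if "i \<noteq> j" "j \<noteq> k" "i \<noteq> k" for i j k
    using eq[of j k i] that c0 by simp
  have rs: "r i - s i = r j - s j" if "i \<noteq> j" for i j
  proof -
    obtain k where "k \<noteq> i" "k \<noteq> j" using third by metis
    then have "r i + s j = - t k" "r j + s i = - t k"
      using dist[of i j k] dist[of j i k] that by (auto simp: eq_neg_iff_add_eq_0)
    then show ?thesis by (simp add: algebra_simps)
  qed
  have rt: "r i - t i = r j - t j" if "i \<noteq> j" for i j
  proof -
    obtain k where "k \<noteq> i" "k \<noteq> j" using third by metis
    then have "r i + t j = - s k" "r j + t i = - s k"
      using dist[of i k j] dist[of j k i] that by (auto simp: eq_neg_iff_add_eq_0 add_ac)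
    then show ?thesis by (simp add: algebra_simps)
  qed
  have offX: "X $ i $ j = c * (r i + s j + t j)" if "i \<noteq> j" for i j using eq[of j j i] that by simp
  have offY: "Y $ i $ j = c * (s i + r j + t j)" if "i \<noteq> j" for i j
    using eq[where i = j and j = i and k = j] that by (simp add: algebra_simps)
  have offZ: "Z $ i $ j = c * (t i + r j + s j)" if "i \<noteq> j" for i j
    using eq[where i = j and j = j and k = i] that by (simp add: algebra_simps)
  define P where "P = sum r UNIV"
  define Q where "Q = sum s UNIV"
  define T where "T = sum t UNIV"
  have row: "(\<Sum>j\<in>UNIV. A $ i $ j) = A $ i $ i + c * ((n - 1) * x i + (sum y UNIV + sum z UNIV) - y i - z i)"
    if "\<And>j. i \<noteq> j \<Longrightarrow> A $ i $ j = c * (x i + y j + z j)" for A :: "complex ^ 'm ^ 'm" and x y z i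
  proof -
    have "(\<Sum>j\<in>UNIV. A $ i $ j) = (\<Sum>j\<in>UNIV. c * (x i + y j + z j) + (if j = i then A $ i $ i - c * (x i + y i + z i) else 0))"
      by (intro sum.cong refl) (use that in auto)
    also have "\<dots> = (c * (n * x i + sum y UNIV + sum z UNIV)) + (A $ i $ i - c * (x i + y i + z i))"
      by (simp add: sum.distrib n_def flip: sum_distrib_left)
    finally show ?thesis by (simp add: algebra_simps)
  qed
  have rX: "r i = X $ i $ i + c * ((n - 1) * r i + (Q + T) - s i - t i)" for i
    unfolding Q_def T_def by (subst r_def) (rule row[OF offX])
  have sY: "s i = Y $ i $ i + c * ((n - 1) * s i + (P + T) - r i - t i)" for i
    unfolding P_def T_def by (subst s_def) (rule row[OF offY])
  have tZ: "t i = Z $ i $ i + c * ((n - 1) * t i + (P + Q) - r i - s i)" for i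
    unfolding P_def Q_def by (subst t_def) (rule row[OF offZ])
  have total: "sum x UNIV = c * ((n - 1) * (sum x UNIV + sum y UNIV + sum z UNIV))"
    if "\<And>i. x i = A $ i $ i + c * ((n - 1) * x i + (sum y UNIV + sum z UNIV) - y i - z i)" "trace A = 0"
    for A :: "complex ^ 'm ^ 'm" and x y z
  proof -
    have "sum x UNIV = (\<Sum>i\<in>UNIV. A $ i $ i + c * ((n - 1) * x i + (sum y UNIV + sum z UNIV) - y i - z i))"
      using that(1) by (intro sum.cong refl) simp
    also have "\<dots> = trace A + c * ((n - 1) * sum x UNIV + n * (sum y UNIV + sum z UNIV) - sum y UNIV - sum z UNIV)"
      by (simp add: trace_def sum.distrib sum_subtractf n_def flip: sum_distrib_left)
    finally show ?thesis using that(2) by (simp add: algebra_simps)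
  qed
  have PQT: "P = c * ((n - 1) * (P + Q + T))" "Q = c * ((n - 1) * (Q + P + T))" "T = c * ((n - 1) * (T + P + Q))"
    using total[OF rX[unfolded Q_def T_def] tr(1)] total[OF sY[unfolded P_def T_def] tr(2)]
      total[OF tZ[unfolded P_def Q_def] tr(3)] unfolding P_def Q_def T_def by blast+
  have "Q = P" "T = P" using PQT by (simp_all add: add_ac)
  then have "P = c * ((n - 1) * (3 * P))" using PQT(1) by simp
  then have "n\<^sup>2 * P = 6 * (n - 1) * P" using n0 unfolding c_def n_def[symmetric] by (simp add: field_simps)
  then have P0: "P = 0" using nat_quadratics(1)[OF card] unfolding n_def by auto
  then have Q0: "Q = 0" and T0: "T = 0" using \<open>Q = P\<close> \<open>T = P\<close> by auto
  have e: "r i + s i + t i = 0" for i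
  proof -
    have diag: "X $ i $ i + Y $ i $ i + Z $ i $ i = c * (r i + s i + t i)" using eq[of i i i] by simp
    have "r i + s i + t i = (X $ i $ i + Y $ i $ i + Z $ i $ i) + c * ((n - 3) * (r i + s i + t i))"
      by (subst rX, subst sY, subst tZ) (simp add: P0 Q0 T0 algebra_simps)
    then have "r i + s i + t i = c * ((n - 2) * (r i + s i + t i))" unfolding diag by (simp add: algebra_simps)
    then have "n\<^sup>2 * (r i + s i + t i) = 2 * (n - 2) * (r i + s i + t i)"
      using n0 unfolding c_def n_def[symmetric] by (simp add: field_simps)
    then show ?thesis using nat_quadratics(2)[OF card] unfolding n_def by auto
  qed
  have "r i = s i" for i
    by (rule const_diff_zero_sums[OF rs]) (use P0 Q0 in \<open>simp_all add: P_def Q_def\<close>)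
  moreover have "r i = t i" for i
    by (rule const_diff_zero_sums[OF rt]) (use P0 T0 in \<open>simp_all add: P_def T_def\<close>)
  ultimately have r0: "r i = 0" "s i = 0" "t i = 0" for i using e[of i] by auto
  have "X $ i $ j = 0" for i j
    using rX[of i] offX[of i j] r0 Q0 T0 by (cases "i = j") auto
  then show "X = 0" by (simp add: vec_eq_iff)
qed

lemma perturbed_unit_modes:
  fixes X :: "complex ^ 'm ^ 'm::finite"
  defines "c \<equiv> 2 / (of_nat CARD('m))\<^sup>2"
  shows "mode1 X perturbed_unit $ i $ j $ k = (if j = k then X $ i $ j else 0) - c * (\<Sum>a\<in>UNIV. X $ i $ a)"
    "mode2 X perturbed_unit $ i $ j $ k = (if i = k then X $ j $ i else 0) - c * (\<Sum>a\<in>UNIV. X $ j $ a)"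
    "mode3 X perturbed_unit $ i $ j $ k = (if i = j then X $ k $ i else 0) - c * (\<Sum>a\<in>UNIV. X $ k $ a)"
proof -
  have *: "(\<Sum>a\<in>UNIV. X $ i $ a * ((if a = j \<and> Q then 1 else 0) - c))
      = (if Q then X $ i $ j else 0) - c * (\<Sum>a\<in>UNIV. X $ i $ a)" for i j :: 'm and Q
  proof -
    have "(\<Sum>a\<in>UNIV. X $ i $ a * ((if a = j \<and> Q then 1 else 0) - c))
        = (\<Sum>a\<in>UNIV. (if a = j then if Q then X $ i $ j else 0 else 0) - c * X $ i $ a)"
      by (intro sum.cong refl) (auto simp: algebra_simps)
    then show ?thesis by (simp add: sum_subtractf sum_distrib_left)
  qed
  show "mode1 X perturbed_unit $ i $ j $ k = (if j = k then X $ i $ j else 0) - c * (\<Sum>a\<in>UNIV. X $ i $ a)"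
    unfolding mode1_def perturbed_unit_def vec_lambda_beta c_def[symmetric] by (rule *)
  have "(\<Sum>a\<in>UNIV. X $ j $ a * ((if i = a \<and> a = k then 1 else 0) - c))
      = (\<Sum>a\<in>UNIV. X $ j $ a * ((if a = i \<and> i = k then 1 else 0) - c))"
    by (intro sum.cong refl) auto
  then show "mode2 X perturbed_unit $ i $ j $ k = (if i = k then X $ j $ i else 0) - c * (\<Sum>a\<in>UNIV. X $ j $ a)"
    unfolding mode2_def perturbed_unit_def vec_lambda_beta c_def[symmetric] * .
  have "(\<Sum>a\<in>UNIV. X $ k $ a * ((if i = j \<and> j = a then 1 else 0) - c))
      = (\<Sum>a\<in>UNIV. X $ k $ a * ((if a = i \<and> i = j then 1 else 0) - c))"
    by (intro sum.cong refl) auto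
  then show "mode3 X perturbed_unit $ i $ j $ k = (if i = j then X $ k $ i else 0) - c * (\<Sum>a\<in>UNIV. X $ k $ a)"
    unfolding mode3_def perturbed_unit_def vec_lambda_beta c_def[symmetric] * .
qed

lemma slice_gram_perturbed_unit:
  "slice_gram (perturbed_unit :: 'm::finite tensor3) i i' = (if i = i' then 1 else 0)"
proof -
  define n where "n = (of_nat CARD('m) :: complex)"
  define c where "c = 2 / n\<^sup>2"
  have n0: "n \<noteq> 0" by (simp add: n_def)
  have cc: "cnj c = c" by (simp add: c_def n_def)
  have "slice_gram (perturbed_unit :: 'm tensor3) i i' = (\<Sum>j\<in>UNIV. \<Sum>k\<in>UNIV.
      ((if i = j \<and> j = k then 1 else 0) - c) * ((if i' = j \<and> j = k then 1 else 0) - c))"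
    unfolding slice_gram_def perturbed_unit_def vec_lambda_beta n_def[symmetric] c_def[symmetric]
    by (intro sum.cong refl) (simp add: cc)
  also have "\<dots> = (\<Sum>j\<in>UNIV. \<Sum>k\<in>UNIV. (if k = j then if j = i then (if i = i' then 1 else 0) - c else 0 else 0)
      + (if k = j then if j = i' then - c else 0 else 0) + c\<^sup>2)"
  proof (intro sum.cong refl)
    fix j k :: 'm
    show "((if i = j \<and> j = k then 1 else 0) - c) * ((if i' = j \<and> j = k then 1 else 0) - c)
      = (if k = j then if j = i then (if i = i' then 1 else 0) - c else 0 else 0)
        + (if k = j then if j = i' then - c else 0 else 0) + c\<^sup>2"
      by (cases "k = j"; cases "j = i"; cases "j = i'") (simp_all add: algebra_simps power2_eq_square)
  qed
  also have "\<dots> = (if i = i' then 1 else 0) - c - c + n * (n * c\<^sup>2)"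
    by (simp add: sum.distrib n_def)
  also have "\<dots> = (if i = i' then 1 else 0)" using n0 by (simp add: c_def power2_eq_square)
  finally show ?thesis .
qed

theorem stable_perturbed_unit:
  assumes "CARD('m::finite) \<ge> 3"
  shows "stable (perturbed_unit :: 'm tensor3)"
proof (rule kempf_ness_stable)
  show "(perturbed_unit :: 'm tensor3) $ j $ k $ i = perturbed_unit $ i $ j $ k" for i j k
    by (auto simp: perturbed_unit_def)
  show "slice_gram (perturbed_unit :: 'm tensor3) i i' = (if i = i' then 1 else 0)" for i i'
    by (rule slice_gram_perturbed_unit)
  fix X Y Z :: "complex ^ 'm ^ 'm"
  assume tr: "trace X = 0" "trace Y = 0" "trace Z = 0"
    and 0: "mode1 X perturbed_unit + mode2 Y perturbed_unit + mode3 Z perturbed_unit = 0"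
  have eq: "(if j = k then X $ i $ j else 0) + (if i = k then Y $ j $ i else 0) + (if i = j then Z $ k $ i else 0)
      = 2 / (of_nat CARD('m))\<^sup>2 * ((\<Sum>a\<in>UNIV. X $ i $ a) + (\<Sum>a\<in>UNIV. Y $ j $ a) + (\<Sum>a\<in>UNIV. Z $ k $ a))" for i j k
  proof -
    have "(mode1 X perturbed_unit + mode2 Y perturbed_unit + mode3 Z perturbed_unit) $ i $ j $ k = 0"
      by (simp add: 0)
    moreover have "x + y + z = u + v + w'" if "(x - u) + (y - v) + (z - w') = 0" for x y z u v w' :: complex
    proof -
      have "(x + y + z) - (u + v + w') = (x - u) + (y - v) + (z - w')" by simp
      then show ?thesis using that by simp
    qed
    ultimately show ?thesis unfolding vector_add_component perturbed_unit_modes distrib_left by blast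
  qed
  have "X = 0" by (rule perturbed_unit_stabilizer_component[OF assms tr eq])
  moreover have "Y = 0"
  proof (rule perturbed_unit_stabilizer_component[OF assms tr(2,3,1)])
    fix i j k
    show "(if j = k then Y $ i $ j else 0) + (if i = k then Z $ j $ i else 0) + (if i = j then X $ k $ i else 0)
      = 2 / (of_nat CARD('m))\<^sup>2 * ((\<Sum>a\<in>UNIV. Y $ i $ a) + (\<Sum>a\<in>UNIV. Z $ j $ a) + (\<Sum>a\<in>UNIV. X $ k $ a))"
      using eq[where i = k and j = i and k = j] by (auto simp: add_ac)
  qed
  moreover have "Z = 0"
  proof (rule perturbed_unit_stabilizer_component[OF assms tr(3,1,2)])
    fix i j k
    show "(if j = k then Z $ i $ j else 0) + (if i = k then X $ j $ i else 0) + (if i = j then Y $ k $ i else 0)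
      = 2 / (of_nat CARD('m))\<^sup>2 * ((\<Sum>a\<in>UNIV. Z $ i $ a) + (\<Sum>a\<in>UNIV. X $ j $ a) + (\<Sum>a\<in>UNIV. Y $ k $ a))"
      using eq[where i = j and j = k and k = i] by (auto simp: add_ac)
  qed
  ultimately show "X = 0 \<and> Y = 0 \<and> Z = 0" by blast
qed

text \<open>A weight vector of length one and sum zero is zero.\<close>

lemma stable_card_1:
  assumes "CARD('m::finite) = 1"
  shows "stable (w :: 'm tensor3)"
proof -
  obtain p :: 'm where p: "UNIV = {p}" using assms card_1_singletonE by blast
  have sum: "sum f UNIV = f p" for f :: "'m \<Rightarrow> real" by (subst p) simp
  have "f i = f p" for f :: "'m \<Rightarrow> real" and i using p by (metis UNIV_I singletonD)
  then have "\<not> one_parameter_weights a b c" for a b c :: "'m \<Rightarrow> real"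
    unfolding one_parameter_weights_def sum by metis
  then show ?thesis unfolding stable_def by blast
qed

section \<open>The case \<open>m = 2\<close>\<close>

definition SL_equiv :: "'m::finite tensor3 \<Rightarrow> 'm tensor3 \<Rightarrow> bool" where
  "SL_equiv v w \<longleftrightarrow> (\<exists>g h l. det g = 1 \<and> det h = 1 \<and> det l = 1 \<and> act g h l v = w)"

lemma SL_equivI: "det g = 1 \<Longrightarrow> det h = 1 \<Longrightarrow> det l = 1 \<Longrightarrow> act g h l v = w \<Longrightarrow> SL_equiv v w"
  unfolding SL_equiv_def by blast

lemma SL_equiv_trans: "SL_equiv u v \<Longrightarrow> SL_equiv v w \<Longrightarrow> SL_equiv u w"
  unfolding SL_equiv_def by (metis act_act det_mul mult_1)

lemma det_inverse_1:
  fixes g :: "complex ^ 'm ^ 'm::finite"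
  assumes "det g = 1" shows "\<exists>g'. det g' = 1 \<and> g' ** g = mat 1"
proof -
  have "invertible g" using assms by (simp add: invertible_det_nz)
  then obtain g' where "g' ** g = mat 1" unfolding invertible_def by blast
  moreover from this have "det g' * det g = 1" by (metis det_I det_mul)
  ultimately show ?thesis using assms by auto
qed

lemma SL_equiv_sym:
  assumes "SL_equiv v w" shows "SL_equiv w v"
proof -
  obtain g h l where *: "det g = 1" "det h = 1" "det l = 1" "act g h l v = w"
    using assms unfolding SL_equiv_def by blast
  obtain g' h' l' where i: "det g' = 1" "g' ** g = mat 1" "det h' = 1" "h' ** h = mat 1"
    "det l' = 1" "l' ** l = mat 1" using det_inverse_1 *(1-3) by metis
  have "act g' h' l' w = v" by (simp add: act_act act_mat1 i flip: *(4))
  then show ?thesis using i by (intro SL_equivI)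
qed

lemma SL_orbit_eq: "SL_orbit w = {v. SL_equiv w v}"
  unfolding SL_orbit_def SL_def SL_equiv_def by (auto simp flip: tensor_act_eq_act)

lemma polynomial_fun_diff:
  assumes "polynomial_fun f" "polynomial_fun g" shows "polynomial_fun (\<lambda>w. f w - g w)"
  using polynomial_fun.add[OF assms(1) polynomial_fun.mult[OF polynomial_fun.const[of "- 1"] assms(2)]] by simp

locale two_indices =
  fixes p q :: "'m::finite"
  assumes pq: "p \<noteq> q" and UNIV_pq: "UNIV = {p, q}"
begin

lemma sum_pq: "sum f UNIV = f p + f q"
  unfolding UNIV_pq using pq by simp

lemma all_pq: "(\<forall>i. P i) \<longleftrightarrow> P p \<and> P q"
  using UNIV_pq by (metis UNIV_I insertE singletonD)

lemma tensor_eq_pq: "(v :: 'a ^ 'm ^ 'm ^ 'm) = w \<longleftrightarrow>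
    v $ p $ p $ p = w $ p $ p $ p \<and> v $ p $ p $ q = w $ p $ p $ q \<and> v $ p $ q $ p = w $ p $ q $ p \<and>
    v $ p $ q $ q = w $ p $ q $ q \<and> v $ q $ p $ p = w $ q $ p $ p \<and> v $ q $ p $ q = w $ q $ p $ q \<and>
    v $ q $ q $ p = w $ q $ q $ p \<and> v $ q $ q $ q = w $ q $ q $ q"
  unfolding vec_eq_iff all_pq by blast

lemma det_pq: "det (A :: complex ^ 'm ^ 'm) = A $ p $ p * A $ q $ q - A $ p $ q * A $ q $ p"
proof -
  have f: "finite {q}" "p \<notin> {q}" using pq by auto
  show ?thesis
    unfolding det_def UNIV_pq
    unfolding sum_over_permutations_insert[OF f]
    unfolding permutes_sing
    using pq by (simp add: sign_swap_id sign_id)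
qed

definition mat2 :: "complex \<Rightarrow> complex \<Rightarrow> complex \<Rightarrow> complex \<Rightarrow> complex ^ 'm ^ 'm" where
  "mat2 a b c d = (\<chi> i j. if i = p then if j = p then a else b else if j = p then c else d)"

lemma mat2_nth [simp]: "mat2 a b c d $ p $ p = a" "mat2 a b c d $ p $ q = b"
    "mat2 a b c d $ q $ p = c" "mat2 a b c d $ q $ q = d"
  using pq by (simp_all add: mat2_def)

lemma det_mat2: "det (mat2 a b c d) = a * d - b * c"
  by (simp add: det_pq)

text \<open>The coefficients of the binary quadratic form \<open>det (x A + y B)\<close>, where \<open>A\<close> and \<open>B\<close> are the two
  slices in the third direction. Its discriminant is Cayley's hyperdeterminant.\<close>

definition disc0 :: "'m tensor3 \<Rightarrow> complex" where
  "disc0 w = w $ p $ p $ p * w $ q $ q $ p - w $ p $ q $ p * w $ q $ p $ p"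
definition disc1 :: "'m tensor3 \<Rightarrow> complex" where
  "disc1 w = w $ p $ p $ p * w $ q $ q $ q + w $ p $ p $ q * w $ q $ q $ p
     - w $ p $ q $ p * w $ q $ p $ q - w $ p $ q $ q * w $ q $ p $ p"
definition disc2 :: "'m tensor3 \<Rightarrow> complex" where
  "disc2 w = w $ p $ p $ q * w $ q $ q $ q - w $ p $ q $ q * w $ q $ p $ q"

definition hyperdet :: "'m tensor3 \<Rightarrow> complex" where
  "hyperdet w = (disc1 w)\<^sup>2 - 4 * disc0 w * disc2 w"

lemma disc_mode1:
  "disc0 (mode1 g w) = det g * disc0 w" "disc1 (mode1 g w) = det g * disc1 w" "disc2 (mode1 g w) = det g * disc2 w"
  by (simp_all add: disc0_def disc1_def disc2_def mode1_def sum_pq det_pq algebra_simps)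

lemma disc_mode2:
  "disc0 (mode2 g w) = det g * disc0 w" "disc1 (mode2 g w) = det g * disc1 w" "disc2 (mode2 g w) = det g * disc2 w"
  by (simp_all add: disc0_def disc1_def disc2_def mode2_def sum_pq det_pq algebra_simps)

lemma disc_mode3:
  "disc0 (mode3 g w) = (g $ p $ p)\<^sup>2 * disc0 w + g $ p $ p * g $ p $ q * disc1 w + (g $ p $ q)\<^sup>2 * disc2 w"
  "disc1 (mode3 g w) = 2 * g $ p $ p * g $ q $ p * disc0 w + (g $ p $ p * g $ q $ q + g $ p $ q * g $ q $ p) * disc1 w
     + 2 * g $ p $ q * g $ q $ q * disc2 w"
  "disc2 (mode3 g w) = (g $ q $ p)\<^sup>2 * disc0 w + g $ q $ p * g $ q $ q * disc1 w + (g $ q $ q)\<^sup>2 * disc2 w"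
  by (simp_all add: disc0_def disc1_def disc2_def mode3_def sum_pq algebra_simps power2_eq_square)

lemma hyperdet_act:
  assumes "det g = 1" "det h = 1" "det l = 1"
  shows "hyperdet (act g h l w) = hyperdet w"
proof -
  have "hyperdet (mode3 l w) = (det l)\<^sup>2 * hyperdet w"
    unfolding hyperdet_def disc_mode3 det_pq by algebra
  then show ?thesis
    using assms by (simp add: act_modes hyperdet_def disc_mode1 disc_mode2)
qed

lemma hyperdet_SL_equiv: "SL_equiv v w \<Longrightarrow> hyperdet w = hyperdet v"
  unfolding SL_equiv_def using hyperdet_act by blast

text \<open>The tensor \<open>s e\<^sub>p \<otimes> e\<^sub>p \<otimes> e\<^sub>p + t e\<^sub>q \<otimes> e\<^sub>q \<otimes> e\<^sub>q\<close>, a Greenberger--Horne--Zeilinger state.\<close>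

definition ghz :: "complex \<Rightarrow> complex \<Rightarrow> 'm tensor3" where
  "ghz s t = (\<chi> i j k. if i = p \<and> j = p \<and> k = p then s else if i = q \<and> j = q \<and> k = q then t else 0)"

lemma ghz_nth [simp]:
  "ghz s t $ p $ p $ p = s" "ghz s t $ p $ p $ q = 0" "ghz s t $ p $ q $ p = 0" "ghz s t $ p $ q $ q = 0"
  "ghz s t $ q $ p $ p = 0" "ghz s t $ q $ p $ q = 0" "ghz s t $ q $ q $ p = 0" "ghz s t $ q $ q $ q = t"
  using pq pq[symmetric] by (simp_all add: ghz_def)

lemma hyperdet_ghz: "hyperdet (ghz s t) = (s * t)\<^sup>2"
  by (simp add: hyperdet_def disc0_def disc1_def disc2_def)

lemma ghz_rescale:
  assumes "s \<noteq> 0" "s' \<noteq> 0" "s * t = s' * t'"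
  shows "SL_equiv (ghz s t) (ghz s' t')"
proof (rule SL_equivI)
  show "det (mat2 (s' / s) 0 0 (s / s')) = 1" using assms by (simp add: det_mat2)
  have "t' = s * t / s'" using assms by (simp add: field_simps)
  then show "act (mat2 (s' / s) 0 0 (s / s')) (mat 1) (mat 1) (ghz s t) = ghz s' t'"
    using assms by (simp add: act_modes mode_mat1 tensor_eq_pq mode1_def sum_pq)
qed simp_all

lemma ghz_flip: "SL_equiv (ghz s t) (ghz (- t) s)"
proof (rule SL_equivI)
  show "det (mat2 0 (- 1) 1 0) = 1" by (simp add: det_mat2)
  then show "det (mat2 0 (- 1) 1 0) = 1" "det (mat2 0 (- 1) 1 0) = 1" by auto
  show "act (mat2 0 (- 1) 1 0) (mat2 0 (- 1) 1 0) (mat2 0 (- 1) 1 0) (ghz s t) = ghz (- t) s"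
    by (simp add: act_modes tensor_eq_pq mode1_def mode2_def mode3_def sum_pq)
qed

text \<open>A binary quadratic form of nonzero discriminant vanishes on two independent vectors, which
  can be scaled to have determinant 1.\<close>

lemma isotropic_basis:
  fixes \<alpha> \<beta> \<gamma> :: complex
  assumes "\<beta>\<^sup>2 - 4 * \<alpha> * \<gamma> \<noteq> 0"
  obtains x y x' y' where "\<alpha> * x\<^sup>2 + \<beta> * x * y + \<gamma> * y\<^sup>2 = 0" "\<alpha> * x'\<^sup>2 + \<beta> * x' * y' + \<gamma> * y'\<^sup>2 = 0"
    "x * y' - y * x' = 1"
proof (cases "\<alpha> = 0")
  case True
  then have "\<beta> \<noteq> 0" using assms by auto
  then show ?thesis using True that[of "- 1 / \<beta>" 0 \<gamma> "- \<beta>"] by (simp add: power2_eq_square)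
next
  case False
  define d where "d = csqrt (\<beta>\<^sup>2 - 4 * \<alpha> * \<gamma>)"
  have d2: "d\<^sup>2 = \<beta>\<^sup>2 - 4 * \<alpha> * \<gamma>" by (simp add: d_def)
  have d0: "d \<noteq> 0" using assms d2 by auto
  have root: "\<alpha> * ((- \<beta> + e) / (2 * \<alpha>))\<^sup>2 + \<beta> * ((- \<beta> + e) / (2 * \<alpha>)) + \<gamma> = 0" if "e\<^sup>2 = d\<^sup>2" for e
  proof -
    have "4 * \<alpha> * (\<alpha> * ((- \<beta> + e) / (2 * \<alpha>))\<^sup>2 + \<beta> * ((- \<beta> + e) / (2 * \<alpha>)) + \<gamma>)
        = (- \<beta> + e)\<^sup>2 + 2 * \<beta> * (- \<beta> + e) + 4 * \<alpha> * \<gamma>"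
      using False by (simp add: field_simps power2_eq_square)
    also have "\<dots> = 0" using that d2 by (simp add: power2_eq_square algebra_simps)
    finally show ?thesis using False by simp
  qed
  define c where "c = \<alpha> / d"
  define x where "x = (- \<beta> + d) / (2 * \<alpha>)"
  define x' where "x' = (- \<beta> + (- d)) / (2 * \<alpha>)"
  have r: "\<alpha> * x\<^sup>2 + \<beta> * x + \<gamma> = 0" "\<alpha> * x'\<^sup>2 + \<beta> * x' + \<gamma> = 0"
    unfolding x_def x'_def by (rule root; simp)+
  show ?thesis
  proof (rule that[of "c * x" c x' 1])
    have "\<alpha> * (c * x)\<^sup>2 + \<beta> * (c * x) * c + \<gamma> * c\<^sup>2 = c\<^sup>2 * (\<alpha> * x\<^sup>2 + \<beta> * x + \<gamma>)"
      by (simp add: power2_eq_square algebra_simps)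
    then show "\<alpha> * (c * x)\<^sup>2 + \<beta> * (c * x) * c + \<gamma> * c\<^sup>2 = 0" using r by simp
    show "\<alpha> * x'\<^sup>2 + \<beta> * x' * 1 + \<gamma> * 1\<^sup>2 = 0" using r by simp
    have "x - x' = d / \<alpha>" using False by (simp add: x_def x'_def field_simps)
    then have "c * (x - x') = 1" using d0 False by (simp add: c_def)
    then show "c * x * 1 - c * x' = 1" by (simp add: algebra_simps)
  qed
qed

lemma rank_one:
  fixes M :: "'m \<Rightarrow> 'm \<Rightarrow> complex"
  assumes "M p p * M q q = M p q * M q p"
  obtains u v where "\<And>i j. M i j = u i * v j"
proof -
  have ij: "(\<forall>i j. M i j = u i * v j)" if "M p p = u p * v p" "M p q = u p * v q" "M q p = u q * v p" "M q q = u q * v q" for u v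
    using that by (simp add: all_pq)
  show ?thesis
  proof (cases "M p p = 0 \<and> M p q = 0")
    case True
    then have "\<forall>i j. M i j = (if i = p then 0 else 1) * M q j" using pq by (intro ij) auto
    then show ?thesis using that[of "\<lambda>i. if i = p then 0 else 1" "M q"] by blast
  next
    case False
    then obtain r where r: "r = p \<or> r = q" "M p r \<noteq> 0" by blast
    then have "\<forall>i j. M i j = (M i r / M p r) * M p j"
      using assms by (intro ij) (auto simp: field_simps)
    then show ?thesis using that[of "\<lambda>i. M i r / M p r" "M p"] by blast
  qed
qed

text \<open>Choosing the third basis isotropic for the form \<open>det (x A + y B)\<close> makes both slices singular,
  hence of the form \<open>u v\<^sup>T\<close> and \<open>u' v'\<^sup>T\<close>. The remaining coefficient of the form is
  \<open>det (u, u') det (v, v')\<close>. As it is nonzero, \<open>u, u'\<close> and \<open>v, v'\<close> are bases, which can be moved to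
  multiples of the standard basis.\<close>

lemma ghz_normal_form:
  assumes "hyperdet w \<noteq> 0"
  obtains t where "SL_equiv w (ghz 1 t)"
proof -
  obtain x y x' y' where xy: "disc0 w * x\<^sup>2 + disc1 w * x * y + disc2 w * y\<^sup>2 = 0"
    "disc0 w * x'\<^sup>2 + disc1 w * x' * y' + disc2 w * y'\<^sup>2 = 0" "x * y' - y * x' = 1"
    using isotropic_basis assms unfolding hyperdet_def by metis
  define l where "l = mat2 x y x' y'"
  have l: "det l = 1" using xy by (simp add: l_def det_mat2)
  define z where "z = mode3 l w"
  have wz: "SL_equiv w z"
    by (rule SL_equivI[of "mat 1" "mat 1" l]) (simp_all add: l act_modes mode_mat1 z_def)
  have z0: "disc0 z = 0" "disc2 z = 0"
    unfolding z_def disc_mode3 using xy by (simp_all add: l_def algebra_simps)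
  have "hyperdet z \<noteq> 0" using hyperdet_SL_equiv[OF wz] assms by simp
  then have z1: "disc1 z \<noteq> 0" using z0 by (auto simp: hyperdet_def)
  obtain u v where uv: "\<And>i j. z $ i $ j $ p = u i * v j"
    using rank_one[of "\<lambda>i j. z $ i $ j $ p"] z0(1) by (auto simp: disc0_def)
  obtain u' v' where uv': "\<And>i j. z $ i $ j $ q = u' i * v' j"
    using rank_one[of "\<lambda>i j. z $ i $ j $ q"] z0(2) by (auto simp: disc2_def)
  define D where "D = u p * u' q - u q * u' p"
  define D' where "D' = v p * v' q - v q * v' p"
  have "disc1 z = D * D'" by (simp add: disc1_def uv uv' D_def D'_def algebra_simps)
  then have D: "D \<noteq> 0" "D' \<noteq> 0" using z1 by auto
  define g where "g = mat2 (u' q / D) (- u' p / D) (- u q) (u p)"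
  define h where "h = mat2 (v' q / D') (- v' p / D') (- v q) (v p)"
  have "det g = 1" "det h = 1"
  proof -
    have "det g = (u p * u' q - u q * u' p) / D" "det h = (v p * v' q - v q * v' p) / D'"
      by (simp_all add: g_def h_def det_mat2 diff_divide_distrib mult_ac)
    then show "det g = 1" "det h = 1" using D by (simp_all flip: D_def D'_def)
  qed
  moreover have gu: "g $ p $ p * u p + g $ p $ q * u q = 1" "g $ q $ p * u p + g $ q $ q * u q = 0"
    "g $ p $ p * u' p + g $ p $ q * u' q = 0" "g $ q $ p * u' p + g $ q $ q * u' q = D"
    using D unfolding g_def by (simp_all add: field_simps) (simp_all add: D_def algebra_simps)
  moreover have hv: "h $ p $ p * v p + h $ p $ q * v q = 1" "h $ q $ p * v p + h $ q $ q * v q = 0"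
    "h $ p $ p * v' p + h $ p $ q * v' q = 0" "h $ q $ p * v' p + h $ q $ q * v' q = D'"
    using D unfolding h_def by (simp_all add: field_simps) (simp_all add: D'_def algebra_simps)
  have "mode1 g (mode2 h z) $ i $ j $ p = (g $ i $ p * u p + g $ i $ q * u q) * (h $ j $ p * v p + h $ j $ q * v q)"
    "mode1 g (mode2 h z) $ i $ j $ q = (g $ i $ p * u' p + g $ i $ q * u' q) * (h $ j $ p * v' p + h $ j $ q * v' q)" for i j
    by (simp_all add: mode1_def mode2_def sum_pq uv uv' algebra_simps)
  then have "mode1 g (mode2 h z) = ghz 1 (D * D')" by (simp add: tensor_eq_pq gu hv)
  ultimately have "SL_equiv z (ghz 1 (D * D'))"
    by (intro SL_equivI[of g h "mat 1"]) (simp_all add: act_modes mode_mat1)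
  then show ?thesis using that SL_equiv_trans[OF wz] by blast
qed

text \<open>The hyperdeterminant of the normal form is \<open>t\<^sup>2\<close>, so it determines \<open>t\<close> up to sign; exchanging
  the two basis vectors in all three factors by a rotation of determinant 1 changes the sign.\<close>

lemma SL_equiv_iff_hyperdet:
  assumes "hyperdet w \<noteq> 0"
  shows "SL_equiv w v \<longleftrightarrow> hyperdet v = hyperdet w"
proof
  assume "hyperdet v = hyperdet w"
  then obtain s t where s: "SL_equiv w (ghz 1 s)" and t: "SL_equiv v (ghz 1 t)"
    using assms ghz_normal_form by metis
  have "s\<^sup>2 = t\<^sup>2"
    using hyperdet_SL_equiv[OF s] hyperdet_SL_equiv[OF t] \<open>hyperdet v = hyperdet w\<close> by (simp add: hyperdet_ghz)
  then consider "s = t" | "s = - t" by (auto simp: power2_eq_iff)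
  then have "SL_equiv (ghz 1 s) (ghz 1 t)"
  proof cases
    case 1
    then show ?thesis using ghz_rescale[of 1 1 s t] by simp
  next
    case 2
    have "t \<noteq> 0" using assms hyperdet_SL_equiv[OF s] 2 by (auto simp: hyperdet_ghz)
    then have "SL_equiv (ghz (- s) 1) (ghz 1 t)" using 2 by (intro ghz_rescale) auto
    then show ?thesis using SL_equiv_trans[OF ghz_flip] by blast
  qed
  then show "SL_equiv w v" using s t SL_equiv_trans SL_equiv_sym by blast
qed (rule hyperdet_SL_equiv)

lemma polynomial_hyperdet: "polynomial_fun hyperdet"
  unfolding hyperdet_def disc0_def disc1_def disc2_def power2_eq_square
  by (intro polynomial_fun_diff polynomial_fun.add polynomial_fun.mult polynomial_fun.coord polynomial_fun.const)

theorem almost_all_polystable: "almost_all (polystable :: 'm tensor3 \<Rightarrow> bool)"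
  unfolding almost_all_def
proof (intro exI conjI ballI)
  show "zariski_open {w. hyperdet w \<noteq> 0}"
    unfolding zariski_open_def zariski_closed_def
    by (rule exI[of _ "{hyperdet}"]) (auto simp: polynomial_hyperdet)
  have "ghz 1 1 \<in> {w. hyperdet w \<noteq> 0}" by (simp add: hyperdet_ghz)
  then show "{w. hyperdet w \<noteq> 0} \<noteq> {}" by blast
  fix w assume "w \<in> {w. hyperdet w \<noteq> 0}"
  then have "SL_orbit w = {v. hyperdet v - hyperdet w = 0}" by (simp add: SL_orbit_eq SL_equiv_iff_hyperdet)
  then show "polystable w"
    unfolding polystable_def zariski_closed_def
    by (intro exI[of _ "{\<lambda>v. hyperdet v - hyperdet w}"])
      (auto intro: polynomial_fun_diff polynomial_hyperdet polynomial_fun.const)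
qed

end

section \<open>Generic tensors are polystable\<close>

theorem proposition4p10:
  "almost_all (polystable :: 'm::finite tensor3 \<Rightarrow> bool)"
proof (cases "CARD('m) = 2")
  case True
  then obtain p q :: 'm where "UNIV = {p, q}" "p \<noteq> q" by (auto simp: card_2_iff)
  then interpret two_indices p q by unfold_locales
  show ?thesis by (rule almost_all_polystable)
next
  case False
  have "CARD('m) \<noteq> 0" by simp
  with False have "CARD('m) = 1 \<or> CARD('m) \<ge> 3" by linarith
  then have "\<exists>w :: 'm tensor3. stable w"
    using stable_card_1 stable_perturbed_unit by blast
  then show ?thesis
    unfolding almost_all_def
    by (intro exI[of _ "{w. stable w}"]) (auto simp: zariski_open_stable stable_imp_polystable)
qed

end
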